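(* Let $d\ge2$ be an integer, let $\gamma>0$, and put $\delta=\frac{1}{2^{d-1}}$. There exist a constant $C_{d,\gamma}<\infty$ and a sequence of real numbers $(\eta_N)_{N\ge1}$ with $\eta_N\to0$ as $N\to\infty$, both depending only on $d$ and $\gamma$, such that the following holds. Let $\alpha\in(0,1]$, let $\phi\in C^\alpha(\mathbb{T}^d)$ be real valued, let $\omega\in\mathbb{T}$ satisfy $$\|k\omega\|\ \ge\ \frac{\gamma}{|k|\,\log^2(|k|+1)}\qquad\text{for all }k\in\mathbb{Z}\setminus\{0\},$$ and let $\phi^{(N)}$ be the $N$-th Birkhoff sum of $\phi$ over the affine skew product $S_\omega:\mathbb{T}^d\to\mathbb{T}^d$, $S_\omega(x_1,x_2,\ldots,x_d)=(x_1+x_2,\,x_2+x_3,\,\ldots,\,x_{d-1}+x_d,\,x_d+\omega)$. Then for all $N\ge1$, $$\left\|\frac1N\,\phi^{(N)}-\int_{\mathbb{T}^d}\phi\right\|_\infty\ \le\ C_{d,\gamma}\,\|\phi\|_\alpha\,\frac{1}{N^{\beta_N}},\qquad \beta_N=\frac{\alpha\delta}{\delta+d}-\eta_N .$$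
   Context: $\mathbb{T}^d=(\mathbb{R}/\mathbb{Z})^d$ is endowed with Haar probability measure. For $t\in\mathbb{R}$, $\|t\|:=\operatorname{dist}(t,\mathbb{Z})$; $\log$ is the natural logarithm. The distance on $\mathbb{T}^d$ is $d(\boldsymbol{x},\boldsymbol{y})=\max_{1\le j\le d}\|x_j-y_j\|$. $\phi^{(N)}(\boldsymbol{x}):=\sum_{j=0}^{N-1}\phi(S_\omega^j\boldsymbol{x})$. $C^\alpha(\mathbb{T}^d)$ is the space of $\alpha$-Hölder continuous functions with norm $\|\phi\|_\alpha:=\|\phi\|_\infty+\sup_{\boldsymbol{x}\ne\boldsymbol{y}}\frac{|\phi(\boldsymbol{x})-\phi(\boldsymbol{y})|}{d(\boldsymbol{x},\boldsymbol{y})^\alpha}$. $\|\cdot\|_\infty$ is the sup norm. *)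

theory Defs
  imports "HOL-Analysis.Analysis"
begin

section \<open>The circle \<open>\<real>/\<int>\<close>\<close>

quotient_type circle = real / "\<lambda>x y :: real. x - y \<in> \<int>"
  morphisms circle_rep to_circle
proof (rule equivpI)
  show "reflp (\<lambda>x y :: real. x - y \<in> \<int>)"
    by (auto simp: reflp_def)
  show "symp (\<lambda>x y :: real. x - y \<in> \<int>)"
    by (auto simp: symp_def) (metis Ints_minus minus_diff_eq)
  show "transp (\<lambda>x y :: real. x - y \<in> \<int>)"
    by (auto simp: transp_def) (metis Ints_add diff_add_cancel add_diff_eq)
qed

instantiation circle :: ab_group_add
begin

lift_definition zero_circle :: circle is "0 :: real" .

lift_definition plus_circle :: "circle \<Rightarrow> circle \<Rightarrow> circle" is "(+)"
  by (metis Ints_add add_diff_add)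

lift_definition uminus_circle :: "circle \<Rightarrow> circle" is "uminus"
  by (metis Ints_minus minus_diff_eq minus_diff_minus)

definition minus_circle :: "circle \<Rightarrow> circle \<Rightarrow> circle" where
  "minus_circle x y = x + (- y)"

instance
proof
  fix a b c :: circle
  show "a + b + c = a + (b + c)" by transfer (simp add: algebra_simps)
  show "a + b = b + a" by transfer (simp add: algebra_simps)
  show "0 + a = a" by transfer simp
  show "- a + a = 0" by transfer simp
  show "a - b = a + - b" by (simp add: minus_circle_def)
qed

end

lift_definition circle_int_mult :: "int \<Rightarrow> circle \<Rightarrow> circle" is
  "\<lambda>k t. of_int k * t"
  by (metis Ints_mult Ints_of_int right_diff_distrib)

lemma infdist_Ints_add: "infdist (t + n) (\<int> :: real set) \<le> infdist t \<int>" if "n \<in> \<int>" for t n :: real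
proof -
  have "infdist (t + n) \<int> \<le> dist t a" if a: "a \<in> \<int>" for a
  proof -
    have "infdist (t + n) \<int> \<le> dist (t + n) (a + n)"
      by (rule infdist_le) (use a \<open>n \<in> \<int>\<close> in auto)
    then show ?thesis by (simp add: dist_real_def)
  qed
  moreover have "(\<int> :: real set) \<noteq> {}" by auto
  ultimately show ?thesis
    by (subst infdist_notempty[of _ t]) (auto intro!: cINF_greatest)
qed

lift_definition circle_norm :: "circle \<Rightarrow> real" is "\<lambda>t. infdist t \<int>"
proof -
  fix x y :: real
  assume "x - y \<in> \<int>"
  then show "infdist x \<int> = infdist y \<int>"
    using infdist_Ints_add[of "x - y" y] infdist_Ints_add[of "y - x" x]
    by (metis Ints_minus add.commute antisym diff_add_cancel minus_diff_eq)
qed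

lemma circle_norm_eq_0_iff: "circle_norm x = 0 \<longleftrightarrow> x = 0"
proof transfer
  fix x :: real
  have "x \<in> \<int> \<longleftrightarrow> infdist x \<int> = 0"
    by (rule in_closed_iff_infdist_zero) (auto simp: closed_Ints)
  then show "infdist x \<int> = 0 \<longleftrightarrow> x - 0 \<in> \<int>" by simp
qed

lemma circle_norm_minus_le: "circle_norm (- x) \<le> circle_norm x"
proof transfer
  fix x :: real
  have "infdist (- x) \<int> \<le> dist x a" if a: "a \<in> \<int>" for a
    using infdist_le[of "- a" \<int> "- x"] a by (simp add: dist_real_def)
  moreover have "(\<int> :: real set) \<noteq> {}" by auto
  ultimately show "infdist (- x) \<int> \<le> infdist x \<int>"
    by (subst infdist_notempty[of _ x]) (auto intro!: cINF_greatest)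
qed

lemma circle_norm_minus: "circle_norm (- x) = circle_norm x"
  using circle_norm_minus_le[of x] circle_norm_minus_le[of "- x"] by simp

lemma circle_norm_triangle: "circle_norm (x + y) \<le> circle_norm x + circle_norm y"
proof transfer
  fix x y :: real
  have ne: "(\<int> :: real set) \<noteq> {}" by auto
  have "infdist (x + y) \<int> - infdist y \<int> \<le> dist x a" if a: "a \<in> \<int>" for a
  proof -
    have "infdist (x + y) \<int> - dist x a \<le> dist y b" if b: "b \<in> \<int>" for b
    proof -
      have "infdist (x + y) \<int> \<le> dist (x + y) (a + b)"
        by (rule infdist_le) (use a b in auto)
      also have "\<dots> \<le> dist x a + dist y b"
        by (rule dist_triangle_add)
      finally show ?thesis by simp
    qed
    then have "infdist (x + y) \<int> - dist x a \<le> infdist y \<int>"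
      by (subst infdist_notempty[of _ y]) (use ne in \<open>auto intro!: cINF_greatest\<close>)
    then show ?thesis by simp
  qed
  then have "infdist (x + y) \<int> - infdist y \<int> \<le> infdist x \<int>"
    by (subst infdist_notempty[of _ x]) (use ne in \<open>auto intro!: cINF_greatest\<close>)
  then show "infdist (x + y) \<int> \<le> infdist x \<int> + infdist y \<int>" by simp
qed

instantiation circle :: metric_space
begin

definition dist_circle :: "circle \<Rightarrow> circle \<Rightarrow> real" where
  "dist_circle x y = circle_norm (x - y)"

definition uniformity_circle :: "(circle \<times> circle) filter" where
  "uniformity_circle = (INF e\<in>{0 <..}. principal {(x, y). dist x y < e})"

definition open_circle :: "circle set \<Rightarrow> bool" where
  "open_circle U \<longleftrightarrow> (\<forall>x\<in>U. eventually (\<lambda>(x', y). x' = x \<longrightarrow> y \<in> U) uniformity)"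

instance
proof
  fix x y z :: circle
  show "dist x y = 0 \<longleftrightarrow> x = y"
    by (simp add: dist_circle_def circle_norm_eq_0_iff)
  have "circle_norm (x - y) \<le> circle_norm (x - z) + circle_norm (z - y)"
    using circle_norm_triangle[of "x - z" "z - y"] by simp
  moreover have "circle_norm (z - y) = circle_norm (y - z)"
    using circle_norm_minus[of "y - z"] by simp
  ultimately show "dist x y \<le> dist x z + dist y z"
    by (simp add: dist_circle_def)
qed (simp_all add: uniformity_circle_def open_circle_def)

end

lemma to_circle_diff: "to_circle x - to_circle y = to_circle (x - y)"
  by (simp add: minus_circle_def plus_circle.abs_eq uminus_circle.abs_eq)

lemma dist_to_circle_le: "dist (to_circle x) (to_circle y) \<le> dist x y"
  using infdist_le[of 0 \<int> "x - y"]
  by (simp add: dist_circle_def to_circle_diff circle_norm.abs_eq dist_real_def)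

lemma continuous_on_to_circle [continuous_intros]: "continuous_on A to_circle"
  unfolding continuous_on_iff using dist_to_circle_le le_less_trans by blast

lemma measurable_to_circle [measurable]: "to_circle \<in> borel_measurable borel"
  by (rule borel_measurable_continuous_onI[OF continuous_on_to_circle])

text \<open>Haar probability measure on the circle. The interval \<open>{0..<1}\<close> is a fundamental domain,
  and \<open>circle_haar_translate\<close> below shows that the choice is immaterial.\<close>

definition circle_haar :: "circle measure" where
  "circle_haar = distr (restrict_space lborel {0..<1}) borel to_circle"

lemma space_circle_haar [simp]: "space circle_haar = UNIV"
  by (simp add: circle_haar_def)

lemma sets_circle_haar [simp, measurable_cong]: "sets circle_haar = sets borel"
  by (simp add: circle_haar_def)

lemma measurable_to_circle_restrict [measurable]:
  "to_circle \<in> measurable (restrict_space lborel {0..<1}) borel"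
  by (rule measurable_restrict_space1) measurable

lemma emeasure_circle_haar:
  assumes "A \<in> sets borel"
  shows "emeasure circle_haar A = emeasure lborel (to_circle -` A \<inter> {0..<1})"
  using assms unfolding circle_haar_def
  by (subst emeasure_distr) (auto simp: emeasure_restrict_space)

lemma emeasure_circle_haar_UNIV: "emeasure circle_haar UNIV = 1"
  by (simp add: emeasure_circle_haar)

lemma to_circle_add_1: "to_circle (x + 1) = to_circle x"
  by (simp add: circle.abs_eq_iff)

lemma to_circle_frac: "to_circle (frac x) = to_circle x"
  by (simp add: circle.abs_eq_iff frac_def)

lemma emeasure_lborel_shift:
  assumes "B \<in> sets (borel :: real measure)"
  shows "emeasure lborel ((+) a -` B) = emeasure lborel B"
  using assms by (subst (2) lborel_distr_plus[of a, symmetric]) (simp add: emeasure_distr)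

lemma circle_haar_translate:
  assumes A: "A \<in> sets borel"
  shows "emeasure circle_haar ((+) c -` A) = emeasure circle_haar A"
proof -
  obtain a where c: "c = to_circle a" and a: "0 \<le> a" "a < 1"
    by (metis Quotient3_circle Quotient3_abs_rep frac_ge_0 frac_lt_1 to_circle_frac)
  have cont: "continuous_on UNIV ((+) c)"
    unfolding continuous_on_iff by (auto simp: dist_circle_def)
  have A': "(+) c -` A \<in> sets borel"
    using measurable_sets[OF borel_measurable_continuous_onI[OF cont] A] by simp
  define B where "B = to_circle -` A"
  have B [measurable]: "B \<in> sets borel"
    unfolding B_def using measurable_sets[OF measurable_to_circle A] by simp
  have per: "x + 1 \<in> B \<longleftrightarrow> x \<in> B" for x
    by (simp add: B_def to_circle_add_1)
  have "to_circle -` ((+) c -` A) \<inter> {0..<1} = (+) a -` (B \<inter> {a..<a + 1})"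
    by (auto simp: B_def c plus_circle.abs_eq)
  then have "emeasure circle_haar ((+) c -` A) = emeasure lborel (B \<inter> {a..<a + 1})"
    using A' emeasure_lborel_shift[of "B \<inter> {a..<a + 1}" a]
    by (simp add: emeasure_circle_haar del: vimage_Int)
  also have "B \<inter> {a..<a + 1} = (B \<inter> {a..<1}) \<union> (B \<inter> {1..<a + 1})"
    using a by auto
  also have "emeasure lborel \<dots> = emeasure lborel (B \<inter> {a..<1}) + emeasure lborel (B \<inter> {1..<a + 1})"
    by (subst plus_emeasure) auto
  also have "emeasure lborel (B \<inter> {1..<a + 1}) = emeasure lborel ((+) 1 -` (B \<inter> {1..<a + 1}))"
    by (subst emeasure_lborel_shift) auto
  also have "(+) 1 -` (B \<inter> {1..<a + 1}) = B \<inter> {0..<a}"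
  proof (rule set_eqI)
    fix x
    show "x \<in> (+) 1 -` (B \<inter> {1..<a + 1}) \<longleftrightarrow> x \<in> B \<inter> {0..<a}"
      using per[of x] by (simp add: add.commute[of 1 x])
  qed
  also have "emeasure lborel (B \<inter> {a..<1}) + emeasure lborel (B \<inter> {0..<a})
      = emeasure lborel ((B \<inter> {a..<1}) \<union> (B \<inter> {0..<a}))"
    by (subst plus_emeasure) auto
  also have "(B \<inter> {a..<1}) \<union> (B \<inter> {0..<a}) = B \<inter> {0..<1}"
    using a by auto
  also have "emeasure lborel \<dots> = emeasure circle_haar A"
    using A by (simp add: emeasure_circle_haar B_def)
  finally show ?thesis .
qed

section \<open>The torus and Hoelder functions\<close>

text \<open>The coordinates \<open>x\<^sub>1, \<dots>, x\<^sub>d\<close> are numbered \<open>x 0, \<dots>, x (d - 1)\<close>. Points of the torus are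
  extensional functions, and a function on the torus is a function on \<open>nat \<Rightarrow> circle\<close> whose values
  outside \<open>torus d\<close> are irrelevant.\<close>

definition torus :: "nat \<Rightarrow> (nat \<Rightarrow> circle) set" where
  "torus d = PiE {..<d} (\<lambda>_. UNIV)"

definition torus_haar :: "nat \<Rightarrow> (nat \<Rightarrow> circle) measure" where
  "torus_haar d = PiM {..<d} (\<lambda>_. circle_haar)"

lemma space_torus_haar: "space (torus_haar d) = torus d"
  by (simp add: torus_haar_def torus_def space_PiM)

text \<open>Meaningful for \<open>d > 0\<close> only: otherwise the maximum is over the empty set.\<close>

definition torus_dist :: "nat \<Rightarrow> (nat \<Rightarrow> circle) \<Rightarrow> (nat \<Rightarrow> circle) \<Rightarrow> real" where
  "torus_dist d x y = Max ((\<lambda>j. circle_norm (x j - y j)) ` {..<d})"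

text \<open>The suprema below are real-valued, hence meaningful only if bounded above. This is the case
  on \<open>holder_functions d \<alpha>\<close> for \<open>d > 0\<close>, \<open>\<alpha> > 0\<close>, since the torus has finite diameter.\<close>

definition sup_norm :: "nat \<Rightarrow> ((nat \<Rightarrow> circle) \<Rightarrow> real) \<Rightarrow> real" where
  "sup_norm d f = (SUP x\<in>torus d. \<bar>f x\<bar>)"

definition holder_functions :: "nat \<Rightarrow> real \<Rightarrow> ((nat \<Rightarrow> circle) \<Rightarrow> real) set" where
  "holder_functions d \<alpha> =
     {f. \<exists>L. \<forall>x\<in>torus d. \<forall>y\<in>torus d. \<bar>f x - f y\<bar> \<le> L * torus_dist d x y powr \<alpha>}"

definition holder_seminorm :: "nat \<Rightarrow> real \<Rightarrow> ((nat \<Rightarrow> circle) \<Rightarrow> real) \<Rightarrow> real" where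
  "holder_seminorm d \<alpha> f =
     (SUP (x, y)\<in>{(x, y). x \<in> torus d \<and> y \<in> torus d \<and> x \<noteq> y}.
        \<bar>f x - f y\<bar> / torus_dist d x y powr \<alpha>)"

definition holder_norm :: "nat \<Rightarrow> real \<Rightarrow> ((nat \<Rightarrow> circle) \<Rightarrow> real) \<Rightarrow> real" where
  "holder_norm d \<alpha> f = sup_norm d f + holder_seminorm d \<alpha> f"

section \<open>The affine skew product\<close>

definition skew_product :: "nat \<Rightarrow> circle \<Rightarrow> (nat \<Rightarrow> circle) \<Rightarrow> nat \<Rightarrow> circle" where
  "skew_product d \<omega> x = (\<lambda>j\<in>{..<d}. if Suc j < d then x j + x (Suc j) else x j + \<omega>)"

lemma skew_product_in_torus: "skew_product d \<omega> x \<in> torus d"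
  by (simp add: skew_product_def torus_def)

definition birkhoff_sum ::
    "nat \<Rightarrow> circle \<Rightarrow> ((nat \<Rightarrow> circle) \<Rightarrow> real) \<Rightarrow> nat \<Rightarrow> (nat \<Rightarrow> circle) \<Rightarrow> real" where
  "birkhoff_sum d \<omega> f N x = (\<Sum>j<N. f ((skew_product d \<omega> ^^ j) x))"

end

theory Submission
  imports Defs
begin

text \<open>The Birkhoff sum of \<open>\<phi>\<close> is compared with that of its Fejer mean of order \<open>M\<close>. To keep all sums
  finite, the convolution is taken over the grid \<open>((1 / 2M) \<int> / \<int>)\<^sup>d\<close>, which integrates exactly all
  products of two characters of frequency below \<open>M\<close>; only the final comparison of the grid average
  with the Haar integral involves measure theory. The smoothing costs \<open>M powr (- \<alpha>)\<close> up to a logarithm.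
  By Parseval on the grid, the discrepancy of the smoothed function is at most \<open>\<parallel>\<phi>\<parallel>\<^sub>\<infinity>\<close> times
  \<open>(2M) powr (d / 2)\<close> times the largest average of a nontrivial character of frequency below \<open>M\<close>
  along an orbit.

  Along an orbit, a character has a polynomial phase of degree \<open>r \<le> d\<close> with leading coefficient
  \<open>k \<omega> / r!\<close>. Weyl differencing, the divisor bound and the Diophantine condition (which separates
  the first \<open>N\<close> multiples of \<open>k \<omega>\<close> by about \<open>1 / (N \<bar>k\<bar>)\<close>) bound such an average by
  \<open>(\<bar>k\<bar> / N) powr \<delta>\<close> up to a subpolynomial factor. All subpolynomial factors go into \<open>\<eta>\<close>.\<close>

section \<open>The divisor bound\<close>

text \<open>One bound has to serve all \<alpha>, \<phi>, \<omega> and starting points, so every loss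
  is a function of N built from d and \<gamma> alone. For the smoothing, t^\<alpha> \<le>
  M^(-\<alpha>) (1 + M t) reduces every \<alpha> to the first moment of the Fejer kernel, at the
  price of a logarithm. Logarithms and divisor counts are tracked only up to growth slower than any
  power; such a function W \<ge> 1 equals N^\<eta> with \<eta> = ln W / ln N, which tends to 0.

  The count behind (|k| / N)^\<delta>: r differencings of a phase of degree r + 1 leave a sum of
  min(N, 1 / ||h_1 ... h_r k \<omega>||) over r-tuples. Collecting equal products leaves the
  multiples of k \<omega> up to N^r, that is N^(r-1) blocks of length N. Up to logarithms, the
  separation makes each block cost N |k|, and the total N^r |k| is divided by N^(r+1). The root of
  order 2^r, r \<le> d - 1, gives \<delta>. For r = 0 there is no block, and the Diophantine bound
  is applied to k \<omega> itself.\<close>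

lemma card_divisors_prime_power_mult:
  fixes p m :: nat
  assumes "prime p" "m > 0"
  shows "card {h. h dvd p ^ a * m} \<le> (a + 1) * card {h. h dvd m}"
proof -
  have sub: "{h. h dvd p ^ a * m} \<subseteq> (\<lambda>(i, h). p ^ i * h) ` ({..a} \<times> {h. h dvd m})"
  proof
    fix h assume "h \<in> {h. h dvd p ^ a * m}"
    then obtain b c where "h = b * c" "b dvd p ^ a" "c dvd m"
      using division_decomp by blast
    moreover from this obtain i where "i \<le> a" "b = p ^ i"
      using assms by (metis divides_primepow_nat)
    ultimately show "h \<in> (\<lambda>(i, h). p ^ i * h) ` ({..a} \<times> {h. h dvd m})"
      by force
  qed
  have "card {h. h dvd p ^ a * m} \<le> card ({..a} \<times> {h. h dvd m})"
    by (rule surj_card_le[OF _ sub]) (use assms in auto)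
  then show ?thesis by (simp add: card_cartesian_product)
qed

text \<open>A prime power p^a in n contributes at most a + 1 divisors. For p \<ge> 2^(1/\<epsilon>)
  this is paid for by p^(\<epsilon> a) \<ge> 2^a \<ge> a + 1. A smaller prime still has
  p^(\<epsilon> a) \<ge> 1 + \<epsilon> a ln 2, and \<open>c\<close> is chosen so that
  \<open>c\<close> times this is at least a + 1. The induction removes one prime with its full
  multiplicity at a time.\<close>

lemma card_divisors_le_prime_factors:
  fixes \<epsilon> :: real
  assumes eps: "\<epsilon> > 0" and n: "(n::nat) > 0"
  defines "c \<equiv> 1 + 1 / (\<epsilon> * ln 2)"
  shows "card {h. h dvd n} \<le> (\<Prod>p | prime (p::nat) \<and> p dvd n. if p < 2 powr (1 / \<epsilon>) then c else 1) * n powr \<epsilon>"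
  using n
proof (induction n rule: less_induct)
  case (less n)
  let ?c = "\<lambda>p::nat. if p < 2 powr (1 / \<epsilon>) then c else 1"
  show ?case
  proof (cases "n = 1")
    case True
    have *: "{p::nat. prime p \<and> p dvd 1} = {}" by auto
    show ?thesis unfolding True * by simp
  next
    case False
    with less.prems obtain p where p: "prime p" "p dvd n"
      using prime_factor_nat by blast
    define a where "a = multiplicity p n"
    obtain m where m: "n = p ^ a * m" "\<not> p dvd m"
      using multiplicity_decompose'[of n p] p less.prems a_def
      by (metis gr_implies_not0 not_prime_unit)
    have a: "a > 0"
      using p less.prems unfolding a_def
      by (metis multiplicity_gt_zero_iff not_prime_unit gr_implies_not0)
    have m0: "m > 0" using m less.prems by (metis gr0I mult_0_right)
    have "p ^ a > 1" using a p by (intro one_less_power) (auto dest: prime_gt_1_nat)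
    then have mn: "m < n" using m m0 by simp
    have set: "{q. prime q \<and> q dvd n} = insert p {q. prime q \<and> q dvd m}"
      using p m a by (auto simp: prime_dvd_mult_iff prime_dvd_power_iff dest: primes_dvd_imp_eq)
    have fin: "finite {q. prime q \<and> q dvd m}"
      using m0 by (simp add: finite_divisors_nat)
    have step: "a + 1 \<le> ?c p * p powr (\<epsilon> * a)"
    proof (cases "p < 2 powr (1 / \<epsilon>)")
      case True
      have "1 + \<epsilon> * a * ln 2 \<le> exp (\<epsilon> * a * ln 2)"
        by (rule exp_ge_add_one_self)
      also have "\<dots> = 2 powr (\<epsilon> * a)" by (simp add: powr_def mult_ac)
      also have "\<dots> \<le> p powr (\<epsilon> * a)"
        using p eps by (intro powr_mono2) (auto dest: prime_ge_2_nat)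
      finally have *: "1 + \<epsilon> * a * ln 2 \<le> p powr (\<epsilon> * a)" .
      have "a + 1 \<le> c * (1 + \<epsilon> * a * ln 2)"
        using eps by (simp add: c_def field_simps)
      also have "\<dots> \<le> c * p powr (\<epsilon> * a)"
        using * eps by (intro mult_left_mono) (auto simp: c_def)
      finally show ?thesis using True by simp
    next
      case False
      have "real (a + 1) \<le> 2 ^ a"
        using less_exp[of a] by (metis Suc_eq_plus1 Suc_leI of_nat_le_iff of_nat_numeral of_nat_power)
      also have "\<dots> = (2 powr (1 / \<epsilon>)) powr (\<epsilon> * a)"
        using eps by (simp add: powr_powr powr_realpow)
      also have "\<dots> \<le> p powr (\<epsilon> * a)"
        using False eps by (intro powr_mono2) auto
      finally show ?thesis using False by simp
    qed
    have "card {h. h dvd n} \<le> (a + 1) * card {h. h dvd m}"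
      using card_divisors_prime_power_mult[OF p(1) m0] m by simp
    then have "real (card {h. h dvd n}) \<le> (a + 1) * real (card {h. h dvd m})"
      by (metis of_nat_le_iff of_nat_mult)
    also have "\<dots> \<le> (?c p * p powr (\<epsilon> * a)) * ((\<Prod>q | prime q \<and> q dvd m. ?c q) * m powr \<epsilon>)"
      using step less.IH[OF mn m0] by (intro mult_mono) auto
    also have "\<dots> = (?c p * (\<Prod>q | prime q \<and> q dvd m. ?c q)) * (p powr (\<epsilon> * a) * m powr \<epsilon>)"
      by (simp only: mult_ac)
    also have "p powr (\<epsilon> * a) * m powr \<epsilon> = n powr \<epsilon>"
      using p m by (simp add: powr_mult powr_powr prime_gt_0_nat mult.commute flip: powr_realpow)
    also have "?c p * (\<Prod>q | prime q \<and> q dvd m. ?c q) = (\<Prod>q | prime q \<and> q dvd n. ?c q)"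
      using m fin unfolding set by (subst prod.insert) auto
    finally show ?thesis .
  qed
qed

text \<open>Only the numbers below 2^(1/\<epsilon>) can carry a factor \<open>c\<close>, and there
  are finitely many of them independently of n.\<close>

lemma card_divisors_subpolynomial:
  fixes \<epsilon> :: real
  assumes eps: "\<epsilon> > 0"
  shows "\<exists>C>0. \<forall>n::nat. n > 0 \<longrightarrow> card {h. h dvd n} \<le> C * n powr \<epsilon>"
proof -
  define c where "c = 1 + 1 / (\<epsilon> * ln 2)"
  define P :: "nat set" where "P = {p. p < 2 powr (1 / \<epsilon>)}"
  have P: "finite P"
    unfolding P_def by (rule finite_subset[of _ "{..nat \<lceil>2 powr (1 / \<epsilon>)\<rceil>}"]) (auto, linarith)
  have c: "c \<ge> 1" using eps by (simp add: c_def)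
  have "card {h. h dvd n} \<le> c ^ card P * n powr \<epsilon>" if "n > 0" for n :: nat
  proof -
    have fin: "finite {p. prime p \<and> p dvd n}" using that by (simp add: finite_divisors_nat)
    have "(\<Prod>p | prime (p::nat) \<and> p dvd n. if p < 2 powr (1 / \<epsilon>) then c else 1)
        = (\<Prod>p\<in>{p. prime p \<and> p dvd n} \<inter> P. c)"
      using fin by (subst prod.inter_restrict) (auto simp: P_def intro!: prod.cong)
    also have "\<dots> \<le> c ^ card P"
      using c P by (simp add: power_increasing card_mono)
    finally have "(\<Prod>p | prime (p::nat) \<and> p dvd n. if p < 2 powr (1 / \<epsilon>) then c else 1) * n powr \<epsilon>
        \<le> c ^ card P * n powr \<epsilon>" by (intro mult_right_mono) auto
    with card_divisors_le_prime_factors[OF eps that] show ?thesis unfolding c_def by linarith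
  qed
  moreover have "c ^ card P > 0" using c by simp
  ultimately show ?thesis by blast
qed

section \<open>Characters of the circle\<close>

lemma circle_int_mult_add_left: "circle_int_mult (a + b) t = circle_int_mult a t + circle_int_mult b t"
  by transfer (simp add: algebra_simps)

lemma circle_int_mult_add_right: "circle_int_mult a (s + t) = circle_int_mult a s + circle_int_mult a t"
  by transfer (simp add: algebra_simps)

lemma circle_int_mult_diff_left: "circle_int_mult (a - b) t = circle_int_mult a t - circle_int_mult b t"
  using circle_int_mult_add_left[of "a - b" b t] by simp

lemma circle_int_mult_diff_right: "circle_int_mult a (s - t) = circle_int_mult a s - circle_int_mult a t"
  using circle_int_mult_add_right[of a "s - t" t] by simp

lemma circle_int_mult_assoc: "circle_int_mult a (circle_int_mult b t) = circle_int_mult (a * b) t"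
  by transfer (simp add: algebra_simps)

lemma circle_int_mult_0_left [simp]: "circle_int_mult 0 t = 0"
  by transfer simp

lemma circle_int_mult_0_right [simp]: "circle_int_mult a 0 = 0"
  by transfer simp

lemma circle_int_mult_1_left [simp]: "circle_int_mult 1 t = t"
  by transfer simp

lemma circle_norm_nonneg [simp]: "circle_norm t \<ge> 0"
  by transfer (rule infdist_nonneg)

lemma infdist_Ints_eq_abs:
  fixes u :: real
  assumes "\<bar>u\<bar> \<le> 1 / 2"
  shows "infdist u \<int> = \<bar>u\<bar>"
proof (rule antisym)
  show "infdist u \<int> \<le> \<bar>u\<bar>"
    using infdist_le[of 0 \<int> u] by (simp add: dist_real_def)
  have "\<bar>u\<bar> \<le> dist u a" if "a \<in> \<int>" for a
  proof (cases "a = 0")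
    case False
    then have "\<bar>a\<bar> \<ge> 1" using that by (simp add: Ints_nonzero_abs_ge1)
    then show ?thesis using assms by (simp add: dist_real_def)
  qed (simp add: dist_real_def)
  moreover have "(\<int> :: real set) \<noteq> {}" by auto
  ultimately show "\<bar>u\<bar> \<le> infdist u \<int>"
    by (subst infdist_notempty) (auto intro!: cINF_greatest)
qed

text \<open>The representative keeps the sign that \<open>circle_norm\<close> forgets; it is what
  lets points of the circle be sorted by the side of 0 on which they lie.\<close>

lemma circle_centered_rep:
  obtains u where "t = to_circle u" "\<bar>u\<bar> \<le> 1 / 2" "circle_norm t = \<bar>u\<bar>"
proof -
  obtain x where x: "t = to_circle x" by (metis Quotient3_circle Quotient3_abs_rep)
  define u where "u = x - of_int (round x)"
  have "t = to_circle u" by (simp add: x u_def circle.abs_eq_iff)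
  moreover have "\<bar>u\<bar> \<le> 1 / 2"
    using of_int_round_abs_le[of x] by (simp add: u_def abs_minus_commute)
  ultimately show ?thesis
    using that[of u] by (simp add: circle_norm.abs_eq infdist_Ints_eq_abs)
qed

lemma circle_norm_le_half: "circle_norm t \<le> 1 / 2"
  by (rule circle_centered_rep[of t]) auto

lift_definition circle_char :: "circle \<Rightarrow> complex" is "\<lambda>t. cis (2 * pi * t)"
proof -
  fix x y :: real
  assume "x - y \<in> \<int>"
  moreover have "cis (2 * pi * x) = cis (2 * pi * y) * cis (2 * pi * (x - y))"
    by (simp add: cis_mult algebra_simps)
  ultimately show "cis (2 * pi * x) = cis (2 * pi * y)"
    by (simp add: cis_multiple_2pi)
qed

lemma circle_char_0 [simp]: "circle_char 0 = 1"
  by transfer simp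

lemma circle_char_add: "circle_char (s + t) = circle_char s * circle_char t"
  by transfer (simp add: cis_mult algebra_simps)

lemma norm_circle_char [simp]: "norm (circle_char t) = 1"
  by transfer simp

lemma cnj_circle_char: "cnj (circle_char t) = circle_char (- t)"
  by transfer (simp add: cis_cnj)

lemma circle_char_diff: "circle_char (s - t) = circle_char s * cnj (circle_char t)"
  using circle_char_add[of s "- t"] by (simp add: cnj_circle_char)

lemma circle_char_sum: "circle_char (\<Sum>i\<in>A. f i) = (\<Prod>i\<in>A. circle_char (f i))"
  by (induction A rule: infinite_finite_induct) (auto simp: circle_char_add)

lemma circle_char_nat_mult: "circle_char (circle_int_mult (int n) t) = circle_char t ^ n"
  by (induction n) (auto simp: circle_int_mult_add_left circle_char_add)

text \<open>Jordan's inequality: sine is concave on [0, pi], so it lies above its chord from 0 to pi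
  / 2.\<close>

lemma sin_pi_ge:
  fixes u :: real
  assumes "0 \<le> u" "u \<le> 1 / 2"
  shows "sin (pi * u) \<ge> 2 * u"
proof -
  have "convex_on {0..pi} (\<lambda>x. - sin x)"
    by (rule f''_ge0_imp_convex[where f' = "\<lambda>x. - cos x" and f'' = "\<lambda>x. sin x"])
      (auto intro!: derivative_eq_intros sin_ge_zero)
  from convex_onD[OF this, of "2 * u" 0 "pi / 2"] show ?thesis
    using assms by (simp add: mult.commute)
qed

text \<open>The chord from 1 to e(u) has length 2 |sin(pi u)|, to which Jordan's inequality applies
  once |u| \<le> 1/2.\<close>

lemma norm_circle_char_minus_1_ge: "norm (circle_char t - 1) \<ge> 4 * circle_norm t"
proof -
  obtain u where u: "t = to_circle u" "\<bar>u\<bar> \<le> 1 / 2" "circle_norm t = \<bar>u\<bar>"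
    by (rule circle_centered_rep)
  have "(norm (cis (2 * pi * u) - 1))\<^sup>2 = (cos (2 * (pi * u)) - 1)\<^sup>2 + (sin (2 * (pi * u)))\<^sup>2"
    by (simp add: cmod_power2 mult.assoc)
  also have "\<dots> = (2 * sin (pi * u))\<^sup>2"
  proof -
    have "(c - 1)\<^sup>2 + s\<^sup>2 = (2 * v)\<^sup>2" if "s\<^sup>2 + c\<^sup>2 = 1" "c = 1 - 2 * v\<^sup>2" for c s v :: real
      using that power2_diff[of c 1] power_mult_distrib[of 2 v 2] by simp
    from this[OF sin_cos_squared_add cos_double_sin] show ?thesis .
  qed
  finally have *: "norm (cis (2 * pi * u) - 1) = 2 * \<bar>sin (pi * u)\<bar>"
    by (intro power2_eq_imp_eq[where y = "2 * \<bar>sin (pi * u)\<bar>", OF _ norm_ge_zero])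
      (simp_all add: power_mult_distrib)
  have "2 * \<bar>u\<bar> \<le> sin (pi * \<bar>u\<bar>)" using u by (intro sin_pi_ge) auto
  also have "\<dots> \<le> \<bar>sin (pi * u)\<bar>" by (cases "u \<ge> 0") auto
  finally show ?thesis using * u by (simp add: circle_char.abs_eq)
qed

text \<open>The minimum of \<open>N\<close> and \<open>1 / circle_norm t\<close>, with the latter read as infinite at \<open>t = 0\<close>,
  where Isabelle's division would give \<open>0\<close>.\<close>

definition recip_cap :: "nat \<Rightarrow> circle \<Rightarrow> real" where
  "recip_cap N t = (if N * circle_norm t \<le> 1 then N else 1 / circle_norm t)"

lemma recip_cap_nonneg [simp]: "recip_cap N t \<ge> 0"
  by (simp add: recip_cap_def)

lemma recip_cap_le: "recip_cap N t \<le> N"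
proof (cases "N * circle_norm t \<le> 1")
  case False
  then have "circle_norm t > 0" by (metis circle_norm_nonneg less_eq_real_def mult_zero_right zero_le_one)
  with False show ?thesis by (simp add: recip_cap_def field_simps)
qed (simp add: recip_cap_def)

lemma recip_cap_le_inverse: "circle_norm t > 0 \<Longrightarrow> recip_cap N t \<le> 1 / circle_norm t"
  by (simp add: recip_cap_def field_simps)

text \<open>The closed form of the geometric sum gives the reciprocal distance, the triangle
  inequality gives N. The length \<open>b\<close> is kept apart from N because differencing shortens
  the range of summation while the bound must stay in terms of N.\<close>

lemma norm_sum_circle_char_power_le:
  assumes "b \<le> N"
  shows "norm (\<Sum>n<b. circle_char t ^ n) \<le> recip_cap N t"
proof (cases "N * circle_norm t \<le> 1")
  case True
  have "norm (\<Sum>n<b. circle_char t ^ n) \<le> (\<Sum>n<b. 1)"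
    by (rule sum_norm_le) (simp add: norm_power)
  then show ?thesis using True assms by (simp add: recip_cap_def)
next
  case False
  then have pos: "circle_norm t > 0"
    by (metis circle_norm_nonneg less_eq_real_def mult_zero_right zero_le_one)
  then have ne: "circle_char t \<noteq> 1"
    using norm_circle_char_minus_1_ge[of t] by auto
  have "norm (\<Sum>n<b. circle_char t ^ n) = norm (circle_char t ^ b - 1) / norm (circle_char t - 1)"
    using ne by (simp add: geometric_sum norm_divide)
  also have "\<dots> \<le> 2 / (4 * circle_norm t)"
    using norm_triangle_ineq4[of "circle_char t ^ b" 1] pos norm_circle_char_minus_1_ge[of t]
    by (intro frac_le) (auto simp: norm_power)
  also have "\<dots> \<le> 1 / circle_norm t" using pos by (simp add: field_simps)
  finally show ?thesis using False by (simp add: recip_cap_def)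
qed

section \<open>Weyl differencing\<close>

lemma sum_triangle_reindex:
  fixes g :: "nat \<Rightarrow> nat \<Rightarrow> 'a :: comm_monoid_add"
  shows "(\<Sum>m<b. \<Sum>n<m. g m n) = (\<Sum>h=1..b. \<Sum>n<b-h. g (n + h) n)"
proof -
  have "(\<Sum>m<b. \<Sum>n<m. g m n) = (\<Sum>(m, n)\<in>(SIGMA m:{..<b}. {..<m}). g m n)"
    by (subst sum.Sigma) auto
  also have "\<dots> = (\<Sum>(h, n)\<in>(SIGMA h:{1..b}. {..<b - h}). g (n + h) n)"
    by (rule sum.reindex_bij_witness[where i = "\<lambda>(h, n). (n + h, n)" and j = "\<lambda>(m, n). (m - n, n)"]) auto
  also have "\<dots> = (\<Sum>h=1..b. \<Sum>n<b-h. g (n + h) n)"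
    by (subst sum.Sigma) auto
  finally show ?thesis .
qed

text \<open>In the expanded square the diagonal gives \<open>b\<close>, and the pairs above and
  below it are conjugate, hence twice a real part; sorting the pairs by h = m - n produces the
  correlations. Extending h up to N makes the bound uniform in \<open>b\<close>.\<close>

lemma norm_sum_squared_le_correlations:
  fixes z :: "nat \<Rightarrow> complex"
  assumes z: "\<And>n. norm (z n) = 1" and bN: "b \<le> N"
  shows "(norm (\<Sum>n<b. z n))\<^sup>2 \<le> N + 2 * (\<Sum>h=1..N. norm (\<Sum>n<b-h. z (n + h) * cnj (z n)))"
proof -
  have "(norm (\<Sum>n<b. z n))\<^sup>2 = b + 2 * Re (\<Sum>m<b. \<Sum>n<m. z m * cnj (z n))"
  proof (induction b)
    case (Suc b)
    have "(norm (\<Sum>n<Suc b. z n))\<^sup>2 = (norm (z b))\<^sup>2 + (norm (\<Sum>n<b. z n))\<^sup>2 + 2 * Re (z b * cnj (\<Sum>n<b. z n))"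
      unfolding cmod_power2
      by (simp add: power2_eq_square algebra_simps sum_negf flip: sum_distrib_left)
    then show ?case
      by (simp add: Suc.IH z sum_distrib_left)
  qed simp
  also have "Re (\<Sum>m<b. \<Sum>n<m. z m * cnj (z n)) \<le> norm (\<Sum>h=1..b. \<Sum>n<b-h. z (n + h) * cnj (z n))"
    unfolding sum_triangle_reindex by (rule complex_Re_le_cmod)
  also have "\<dots> \<le> (\<Sum>h=1..b. norm (\<Sum>n<b-h. z (n + h) * cnj (z n)))"
    by (rule norm_sum)
  also have "\<dots> \<le> (\<Sum>h=1..N. norm (\<Sum>n<b-h. z (n + h) * cnj (z n)))"
    using bN by (intro sum_mono2) auto
  finally show ?thesis using bN by simp
qed

text \<open>Cauchy-Schwarz iterated r times. Normalising by N instead of \<open>card I\<close> is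
  harmless since \<open>card I \<le> N\<close>.\<close>

lemma mean_power_two_power_le:
  fixes a :: "'a \<Rightarrow> real"
  assumes "N > 0" "card I \<le> N"
  shows "((\<Sum>i\<in>I. a i) / N) ^ (2 ^ r) \<le> (\<Sum>i\<in>I. a i ^ (2 ^ r)) / N"
proof (induction r)
  case (Suc r)
  \<comment> \<open>The \<open>a i\<close> may be negative, so squaring both sides of the induction
    hypothesis needs an even exponent; for r = 0 the exponent is 1 and \<open>sq\<close> is applied
    directly.\<close>
  have pos: "((\<Sum>i\<in>I. a i) / N) ^ (2 ^ r) \<ge> 0" if "r > 0"
    using that by (intro zero_le_even_power) simp
  have sq: "((\<Sum>i\<in>I. f i) / N)\<^sup>2 \<le> (\<Sum>i\<in>I. (f i)\<^sup>2) / N" for f :: "'a \<Rightarrow> real"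
  proof -
    have "(\<Sum>i\<in>I. f i)\<^sup>2 \<le> (\<Sum>i\<in>I. (f i)\<^sup>2) * card I"
      by (rule sum_squared_le_sum_of_squares)
    also have "\<dots> \<le> (\<Sum>i\<in>I. (f i)\<^sup>2) * N"
      using assms by (intro mult_left_mono sum_nonneg) auto
    finally show ?thesis using assms by (simp add: field_simps power2_eq_square)
  qed
  show ?case
  proof (cases "r = 0")
    case False
    have "((\<Sum>i\<in>I. a i) / N) ^ (2 ^ Suc r) = (((\<Sum>i\<in>I. a i) / N) ^ (2 ^ r))\<^sup>2"
      by (simp add: mult.commute flip: power_mult)
    also have "\<dots> \<le> ((\<Sum>i\<in>I. a i ^ (2 ^ r)) / N)\<^sup>2"
      using Suc.IH pos False by (intro power_mono) auto
    also have "\<dots> \<le> (\<Sum>i\<in>I. (a i ^ (2 ^ r))\<^sup>2) / N" by (rule sq)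
    finally show ?thesis by (simp add: mult.commute flip: power_mult)
  qed (use sq[of a] in simp)
qed simp

text \<open>Sequences in the circle that behave like a polynomial of degree \<open>r\<close> with leading
  coefficient \<open>\<theta> / r!\<close>; dividing by \<open>r!\<close> makes no sense in the circle.\<close>

fun poly_seq :: "nat \<Rightarrow> circle \<Rightarrow> (nat \<Rightarrow> circle) \<Rightarrow> bool" where
  "poly_seq 0 \<theta> f \<longleftrightarrow> (\<forall>n. f n = \<theta>)"
| "poly_seq (Suc r) \<theta> f \<longleftrightarrow> (\<forall>h. poly_seq r (circle_int_mult (int h) \<theta>) (\<lambda>n. f (n + h) - f n))"

text \<open>Unfolded: the sum of \<open>recip_cap N\<close> at h_1 ... h_r \<theta> over all
  r-tuples from {1..N}, one h_i for each differencing.\<close>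

fun weyl_majorant :: "nat \<Rightarrow> nat \<Rightarrow> circle \<Rightarrow> real" where
  "weyl_majorant N 0 \<theta> = recip_cap N \<theta>"
| "weyl_majorant N (Suc r) \<theta> = (\<Sum>h=1..N. weyl_majorant N r (circle_int_mult (int h) \<theta>))"

lemma weyl_majorant_nonneg: "weyl_majorant N r \<theta> \<ge> 0"
  by (induction r arbitrary: \<theta>) (auto intro: sum_nonneg)

text \<open>Squaring the sum replaces the phase by its differences, which have degree one less and
  leading coefficient h \<theta>. The mean of the correlations is raised to the power 2^r termwise,
  where the induction hypothesis applies to each of them. It is used for the shortened range b - h
  but the same N, which is why \<open>b\<close> is quantified separately. \<open>C\<close> depends
  on r only.\<close>

lemma weyl_differencing:
  "\<exists>C>0. \<forall>N b f \<theta>. N > 0 \<longrightarrow> b \<le> N \<longrightarrow> poly_seq (Suc r) \<theta> f \<longrightarrow>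
     (norm (\<Sum>n<b. circle_char (f n)) / N) ^ (2 ^ r) \<le> C * (1 / N + weyl_majorant N r \<theta> / N ^ Suc r)"
proof (induction r)
  case 0
  have "norm (\<Sum>n<b. circle_char (f n)) / N \<le> 1 / N + recip_cap N \<theta> / N"
    if N: "N > 0" "b \<le> N" and f: "poly_seq (Suc 0) \<theta> f" for N b f \<theta>
  proof -
    have "f n = f 0 + circle_int_mult (int n) \<theta>" for n
    proof -
      from f have "f (0 + n) - f 0 = circle_int_mult (int n) \<theta>"
        unfolding poly_seq.simps by blast
      then show ?thesis by (simp add: algebra_simps)
    qed
    then have "(\<Sum>n<b. circle_char (f n)) = (\<Sum>n<b. circle_char (f 0) * circle_char \<theta> ^ n)"
      by (metis circle_char_add circle_char_nat_mult)
    then have "norm (\<Sum>n<b. circle_char (f n)) = norm (\<Sum>n<b. circle_char \<theta> ^ n)"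
      by (simp add: norm_mult flip: sum_distrib_left)
    also have "\<dots> \<le> recip_cap N \<theta>"
      using N by (intro norm_sum_circle_char_power_le)
    finally have "norm (\<Sum>n<b. circle_char (f n)) / N \<le> recip_cap N \<theta> / N"
      by (intro divide_right_mono) auto
    then show ?thesis by (simp add: add_increasing)
  qed
  then show ?case by (intro exI[of _ 1]) auto
next
  case (Suc r)
  then obtain C where C: "C > 0" and IH: "\<And>N b f \<theta>. N > 0 \<Longrightarrow> b \<le> N \<Longrightarrow> poly_seq (Suc r) \<theta> f \<Longrightarrow>
     (norm (\<Sum>n<b. circle_char (f n)) / N) ^ (2 ^ r) \<le> C * (1 / N + weyl_majorant N r \<theta> / N ^ Suc r)"
    by blast
  define q :: nat where "q = 2 ^ r"
  have q: "q \<ge> 1" by (simp add: q_def)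
  have "(norm (\<Sum>n<b. circle_char (f n)) / N) ^ (2 ^ Suc r)
      \<le> 4 ^ q * (1 + C) * (1 / N + weyl_majorant N (Suc r) \<theta> / N ^ Suc (Suc r))"
    if N: "N > 0" "b \<le> N" and f: "poly_seq (Suc (Suc r)) \<theta> f" for N b f \<theta>
  proof -
    define a where "a h = norm (\<Sum>n<b-h. circle_char (f (n + h) - f n)) / N" for h
    have a0: "a h \<ge> 0" for h by (simp add: a_def)
    have "(norm (\<Sum>n<b. circle_char (f n)))\<^sup>2
        \<le> N + 2 * (\<Sum>h=1..N. norm (\<Sum>n<b-h. circle_char (f (n + h)) * cnj (circle_char (f n))))"
      using N by (intro norm_sum_squared_le_correlations) auto
    also have "\<dots> = N + 2 * (\<Sum>h=1..N. N * a h)"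
      using N by (simp add: a_def circle_char_diff)
    also have "\<dots> = (1 / N + 2 * ((\<Sum>h=1..N. a h) / N)) * N\<^sup>2"
      using N by (simp add: sum_distrib_left[symmetric] power2_eq_square field_simps)
    finally have *: "(norm (\<Sum>n<b. circle_char (f n)) / N)\<^sup>2 \<le> 1 / N + 2 * ((\<Sum>h=1..N. a h) / N)"
      using N by (simp add: field_simps)
    have sum0: "(\<Sum>h=1..N. a h) / N \<ge> 0" using a0 by (simp add: sum_nonneg)
    have "(norm (\<Sum>n<b. circle_char (f n)) / N) ^ (2 ^ Suc r)
        = ((norm (\<Sum>n<b. circle_char (f n)) / N)\<^sup>2) ^ q"
      by (simp add: q_def flip: power_mult)
    also have "\<dots> \<le> (1 / N + 2 * ((\<Sum>h=1..N. a h) / N)) ^ q"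
      using * by (intro power_mono) auto
    \<comment> \<open>Twice the maximum stands in for the binomial expansion of the q-th power;
      together with the factor 2 of the correlations this is the source of 4^q.\<close>
    also have "\<dots> \<le> (2 * max (1 / N) (2 * ((\<Sum>h=1..N. a h) / N))) ^ q"
      using sum0 by (intro power_mono) auto
    also have "\<dots> \<le> (4 * max (1 / N) ((\<Sum>h=1..N. a h) / N)) ^ q"
      using sum0 by (intro power_mono) auto
    also have "\<dots> = 4 ^ q * max ((1 / N) ^ q) (((\<Sum>h=1..N. a h) / N) ^ q)"
      using sum0 by (auto simp: power_mult_distrib max_def intro!: antisym power_mono)
    also have "\<dots> \<le> 4 ^ q * ((1 / N) ^ q + ((\<Sum>h=1..N. a h) / N) ^ q)"
      using sum0 by (intro mult_left_mono) auto
    also have "\<dots> \<le> 4 ^ q * (1 / N + (\<Sum>h=1..N. a h ^ q) / N)"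
    proof -
      have "(1 / real N) ^ q \<le> (1 / N) ^ 1"
        using N q by (intro power_decreasing) auto
      moreover have "((\<Sum>h=1..N. a h) / N) ^ q \<le> (\<Sum>h=1..N. a h ^ q) / N"
        unfolding q_def using N by (intro mean_power_two_power_le) auto
      ultimately show ?thesis by (intro mult_left_mono add_mono) auto
    qed
    also have "(\<Sum>h=1..N. a h ^ q)
        \<le> (\<Sum>h=1..N. C * (1 / N + weyl_majorant N r (circle_int_mult (int h) \<theta>) / N ^ Suc r))"
    proof (rule sum_mono)
      fix h
      have "poly_seq (Suc r) (circle_int_mult (int h) \<theta>) (\<lambda>n. f (n + h) - f n)"
        using f unfolding poly_seq.simps(2)[of "Suc r"] by blast
      then show "a h ^ q \<le> C * (1 / N + weyl_majorant N r (circle_int_mult (int h) \<theta>) / N ^ Suc r)"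
        using IH[of N "b - h"] N unfolding a_def q_def by simp
    qed
    also have "\<dots> = C * (1 + weyl_majorant N (Suc r) \<theta> / N ^ Suc r)"
      using N by (simp add: sum_distrib_left[symmetric] sum.distrib sum_divide_distrib[symmetric])
    also have "4 ^ q * (1 / N + C * (1 + weyl_majorant N (Suc r) \<theta> / N ^ Suc r) / N)
        = 4 ^ q * ((1 + C) * (1 / N) + C * (weyl_majorant N (Suc r) \<theta> / N ^ Suc (Suc r)))"
      using N by (simp add: field_simps)
    also have "\<dots> \<le> 4 ^ q * ((1 + C) * (1 / N) + (1 + C) * (weyl_majorant N (Suc r) \<theta> / N ^ Suc (Suc r)))"
      using C weyl_majorant_nonneg[of N "Suc r" \<theta>]
      by (intro mult_left_mono add_mono mult_right_mono) auto
    also have "\<dots> = 4 ^ q * (1 + C) * (1 / N + weyl_majorant N (Suc r) \<theta> / N ^ Suc (Suc r))"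
      by (simp only: distrib_left distrib_right mult.assoc)
    finally show ?thesis
      by (simp add: mult_left_mono divide_right_mono)
  qed
  moreover have "4 ^ q * (1 + C) > 0" using C by simp
  ultimately show ?case by blast
qed

section \<open>Sums of reciprocal distances\<close>

text \<open>On each side of 0, cut the distances to 0 into cells of length \<kappa>. By separation a
  cell holds at most one point; cell 0 costs at most N and cell n \<ge> 1 at most 1 / (\<kappa> n).
  The harmonic sum up to 1 / \<kappa> gives the logarithm, the two sides give the factor 2.\<close>

lemma sum_recip_cap_separated:
  fixes x :: "'a \<Rightarrow> circle"
  assumes fin: "finite I" and \<kappa>: "\<kappa> > 0"
    and sep: "\<And>i j. i \<in> I \<Longrightarrow> j \<in> I \<Longrightarrow> i \<noteq> j \<Longrightarrow> circle_norm (x i - x j) \<ge> \<kappa>"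
  shows "(\<Sum>i\<in>I. recip_cap N (x i)) \<le> 2 * (N + (1 + ln (1 + 1 / \<kappa>)) / \<kappa>)"
proof -
  obtain u where u: "\<And>i. x i = to_circle (u i)" "\<And>i. \<bar>u i\<bar> \<le> 1 / 2" "\<And>i. circle_norm (x i) = \<bar>u i\<bar>"
  proof -
    have "\<exists>u. x i = to_circle u \<and> \<bar>u\<bar> \<le> 1 / 2 \<and> circle_norm (x i) = \<bar>u\<bar>" for i
      by (rule circle_centered_rep[of "x i"]) blast
    then have "\<forall>i. \<exists>u. x i = to_circle u \<and> \<bar>u\<bar> \<le> 1 / 2 \<and> circle_norm (x i) = \<bar>u\<bar>"
      by simp
    then have "\<exists>u. \<forall>i. x i = to_circle (u i) \<and> \<bar>u i\<bar> \<le> 1 / 2 \<and> circle_norm (x i) = \<bar>u i\<bar>"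
      by (intro choice)
    then show ?thesis using that by blast
  qed
  define w where "w i = nat \<lfloor>\<bar>u i\<bar> / \<kappa>\<rfloor>" for i
  define W where "W = nat \<lfloor>1 / \<kappa>\<rfloor>"
  define G where "G n = (if n = 0 then real N else 1 / (\<kappa> * n))" for n :: nat
  have G0: "G n \<ge> 0" for n using \<kappa> by (simp add: G_def)
  have w_le: "w i * \<kappa> \<le> \<bar>u i\<bar>" and less_w: "\<bar>u i\<bar> < (w i + 1) * \<kappa>" for i
  proof -
    have "real (w i) \<le> \<bar>u i\<bar> / \<kappa>" "\<bar>u i\<bar> / \<kappa> < real (w i) + 1"
      using \<kappa> unfolding w_def by (auto intro!: of_nat_floor)
    then show "w i * \<kappa> \<le> \<bar>u i\<bar>" "\<bar>u i\<bar> < (w i + 1) * \<kappa>"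
      using \<kappa> by (simp_all add: field_simps)
  qed
  have wW: "w i \<le> W" for i
    unfolding w_def W_def using \<kappa> u(2)[of i]
    by (intro nat_mono floor_mono divide_right_mono) auto
  have cap: "recip_cap N (x i) \<le> G (w i)" for i
  proof (cases "w i = 0")
    case False
    then have "0 < w i * \<kappa>" using \<kappa> by simp
    then have "recip_cap N (x i) \<le> 1 / \<bar>u i\<bar>"
      using recip_cap_le_inverse[of "x i" N] w_le[of i] u(3)[of i] by simp
    also have "\<dots> \<le> 1 / (w i * \<kappa>)"
      using \<open>0 < w i * \<kappa>\<close> w_le[of i] by (intro divide_left_mono) auto
    finally show ?thesis using False by (simp add: G_def mult.commute)
  qed (simp add: G_def recip_cap_le)
  \<comment> \<open>The condition on \<open>J\<close> expresses that its points lie on one side of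
    0: there the distance of two representatives is the difference of their absolute values, so two
    points in one cell would be closer than \<kappa>.\<close>
  have half: "(\<Sum>i\<in>J. recip_cap N (x i)) \<le> N + (1 + ln (1 + 1 / \<kappa>)) / \<kappa>"
    if J: "J \<subseteq> I" and sgn: "\<And>i j. i \<in> J \<Longrightarrow> j \<in> J \<Longrightarrow> \<bar>u i - u j\<bar> = \<bar>\<bar>u i\<bar> - \<bar>u j\<bar>\<bar>" for J
  proof -
    have inj: "inj_on w J"
    proof (rule inj_onI, rule ccontr)
      fix i j assume ij: "i \<in> J" "j \<in> J" "w i = w j" "i \<noteq> j"
      have "\<kappa> \<le> circle_norm (x i - x j)" using sep ij J by blast
      also have "\<dots> \<le> \<bar>u i - u j\<bar>"
        using dist_to_circle_le[of "u i" "u j"] u(1) by (simp add: dist_circle_def dist_real_def)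
      also have "\<dots> < \<kappa>"
        unfolding sgn[OF ij(1,2)] using w_le[of i] w_le[of j] less_w[of i] less_w[of j] ij(3)
        by (simp add: abs_less_iff algebra_simps)
      finally show False by simp
    qed
    have "(\<Sum>i\<in>J. recip_cap N (x i)) \<le> (\<Sum>i\<in>J. G (w i))" by (intro sum_mono cap)
    also have "\<dots> = (\<Sum>n\<in>w ` J. G n)" using inj by (simp add: sum.reindex)
    also have "\<dots> \<le> (\<Sum>n\<in>{..W}. G n)"
      using wW G0 by (intro sum_mono2) auto
    also have "{..W} = insert 0 {1..W}" by auto
    also have "(\<Sum>n\<in>insert 0 {1..W}. G n) = N + (\<Sum>n=1..W. (1 / \<kappa>) * inverse (real n))"
      by (subst sum.insert) (auto simp: G_def field_simps intro!: sum.cong)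
    also have "(\<Sum>n=1..W. (1 / \<kappa>) * inverse (real n)) = (1 / \<kappa>) * harm W"
      by (simp add: harm_def sum_distrib_left)
    also have "harm W \<le> 1 + ln (1 + 1 / \<kappa>)"
    proof (cases "W = 0")
      case False
      then have "harm W \<le> ln (real W) + 1" using euler_mascheroni_sequence_decreasing[of 1 W] by (simp add: harm_def)
      moreover have "real W \<le> 1 / \<kappa>" unfolding W_def using \<kappa> by (intro of_nat_floor) auto
      moreover from this have "ln (real W) \<le> ln (1 + 1 / \<kappa>)"
        using False by (intro ln_mono) auto
      ultimately show ?thesis by linarith
    qed (use \<kappa> in \<open>simp add: harm_def\<close>)
    finally show ?thesis using \<kappa> by (simp add: mult_left_mono divide_right_mono)
  qed
  have "(\<Sum>i\<in>I. recip_cap N (x i))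
      = (\<Sum>i\<in>I \<inter> {i. u i \<ge> 0}. recip_cap N (x i)) + (\<Sum>i\<in>I - {i. u i \<ge> 0}. recip_cap N (x i))"
    using fin by (rule sum.Int_Diff)
  also have "\<dots> \<le> (N + (1 + ln (1 + 1 / \<kappa>)) / \<kappa>) + (N + (1 + ln (1 + 1 / \<kappa>)) / \<kappa>)"
    by (intro add_mono half) auto
  finally show ?thesis by simp
qed

text \<open>For fixed m = h l the factor h determines l, so each m \<le> N L is hit at most as often
  as it has divisors.\<close>

lemma sum_products_le_divisor_sum:
  fixes g :: "nat \<Rightarrow> real"
  assumes g: "\<And>n. g n \<ge> 0" and \<tau>: "\<And>m. 0 < m \<Longrightarrow> m \<le> N * L \<Longrightarrow> real (card {h. h dvd m}) \<le> \<tau>"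
  shows "(\<Sum>h=1..N. \<Sum>l=1..L. g (h * l)) \<le> \<tau> * (\<Sum>m=1..N*L. g m)"
proof -
  have "(\<Sum>h=1..N. \<Sum>l=1..L. g (h * l)) = (\<Sum>(h, l)\<in>{1..N} \<times> {1..L}. g (h * l))"
    by (simp add: sum.cartesian_product)
  also have "\<dots> = (\<Sum>m\<in>{1..N*L}. \<Sum>(h, l)\<in>{p \<in> {1..N} \<times> {1..L}. (\<lambda>(h, l). h * l) p = m}. g (h * l))"
    by (rule sum.group[symmetric]) (auto intro!: mult_le_mono Suc_leI)
  also have "\<dots> \<le> (\<Sum>m=1..N*L. \<tau> * g m)"
  proof (rule sum_mono)
    fix m assume m: "m \<in> {1..N*L}"
    let ?S = "{p \<in> {1..N} \<times> {1..L}. (\<lambda>(h, l). h * l) p = m}"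
    have "inj_on fst ?S" by (auto simp: inj_on_def)
    moreover have "fst ` ?S \<subseteq> {h. h dvd m}" by auto
    ultimately have "card ?S \<le> card {h. h dvd m}"
      using m by (intro card_inj_on_le) auto
    then have "real (card ?S) \<le> \<tau>"
      using \<tau>[of m] m by simp
    moreover have "(\<Sum>(h, l)\<in>?S. g (h * l)) = (\<Sum>p\<in>?S. g m)"
      by (rule sum.cong) auto
    ultimately show "(\<Sum>(h, l)\<in>?S. g (h * l)) \<le> \<tau> * g m"
      using g by (simp add: mult_right_mono)
  qed
  finally show ?thesis by (simp add: sum_distrib_left)
qed

text \<open>Merging one h with the product of the others collapses the r-fold sum step by step into
  a single sum over l \<le> N^r; every merge costs one divisor factor \<tau>.\<close>

lemma weyl_majorant_le:
  assumes \<tau>: "\<And>m. 0 < m \<Longrightarrow> m \<le> N ^ r \<Longrightarrow> real (card {h. h dvd m}) \<le> \<tau>" and N: "N > 0" and \<tau>1: "\<tau> \<ge> 0"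
  shows "weyl_majorant N r \<theta> \<le> \<tau> ^ r * (\<Sum>l=1..N^r. recip_cap N (circle_int_mult (int l) \<theta>))"
  using \<tau>
proof (induction r arbitrary: \<theta>)
  case (Suc r)
  have le: "N ^ r \<le> N ^ Suc r" using N by simp
  have "weyl_majorant N (Suc r) \<theta> \<le> (\<Sum>h=1..N. \<tau> ^ r *
      (\<Sum>l=1..N^r. recip_cap N (circle_int_mult (int l) (circle_int_mult (int h) \<theta>))))"
    unfolding weyl_majorant.simps
    using Suc.prems order_trans[OF _ le] by (intro sum_mono Suc.IH) blast
  also have "\<dots> = \<tau> ^ r * (\<Sum>h=1..N. \<Sum>l=1..N^r. recip_cap N (circle_int_mult (int (h * l)) \<theta>))"
    by (simp add: sum_distrib_left circle_int_mult_assoc mult.commute)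
  also have "\<dots> \<le> \<tau> ^ r * (\<tau> * (\<Sum>l=1..N*N^r. recip_cap N (circle_int_mult (int l) \<theta>)))"
    using Suc.prems \<tau>1 by (intro mult_left_mono sum_products_le_divisor_sum) auto
  finally show ?case by (simp add: mult_ac)
qed simp

text \<open>Two multiples in a block of N consecutive ones differ by j \<theta> with 0 < j < N, so
  every block is \<kappa>-separated, wherever it starts. There are m blocks.\<close>

lemma sum_recip_cap_multiples_le:
  assumes \<kappa>: "\<kappa> > 0" and N: "N > 0"
    and sep: "\<And>j. 0 < j \<Longrightarrow> j < N \<Longrightarrow> circle_norm (circle_int_mult (int j) \<theta>) \<ge> \<kappa>"
  shows "(\<Sum>l=1..m*N. recip_cap N (circle_int_mult (int l) \<theta>)) \<le> m * (2 * (N + (1 + ln (1 + 1 / \<kappa>)) / \<kappa>))"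
proof -
  let ?g = "\<lambda>l. recip_cap N (circle_int_mult (int l) \<theta>)"
  have "(\<Sum>l=1..m*N. ?g l) = (\<Sum>l<m*N. ?g (Suc l))"
    by (simp add: sum.atLeast1_atMost_eq)
  also have "\<dots> = (\<Sum>b<m. \<Sum>l\<in>{b*N..<b*N+N}. ?g (Suc l))"
    by (rule sum.nat_group[symmetric])
  also have "\<dots> \<le> (\<Sum>b<m. 2 * (N + (1 + ln (1 + 1 / \<kappa>)) / \<kappa>))"
  proof (intro sum_mono sum_recip_cap_separated[where x = "\<lambda>l. circle_int_mult (int (Suc l)) \<theta>"] \<kappa>)
    fix b i j assume ij: "i \<in> {b*N..<b*N+N}" "j \<in> {b*N..<b*N+N}" "i \<noteq> j"
    have *: "\<kappa> \<le> circle_norm (circle_int_mult (int (Suc i)) \<theta> - circle_int_mult (int (Suc j)) \<theta>)"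
      if "i \<in> {b*N..<b*N+N}" "j \<in> {b*N..<b*N+N}" "j < i" for i j
    proof -
      have "circle_int_mult (int (Suc i)) \<theta> - circle_int_mult (int (Suc j)) \<theta> = circle_int_mult (int (i - j)) \<theta>"
        using that by (simp add: of_nat_diff flip: circle_int_mult_diff_left)
      then show ?thesis using sep[of "i - j"] that by auto
    qed
    show "\<kappa> \<le> circle_norm (circle_int_mult (int (Suc i)) \<theta> - circle_int_mult (int (Suc j)) \<theta>)"
    proof (cases "j < i")
      case False
      then have "\<kappa> \<le> circle_norm (- (circle_int_mult (int (Suc i)) \<theta> - circle_int_mult (int (Suc j)) \<theta>))"
        unfolding minus_diff_eq using ij by (intro *) auto
      then show ?thesis by (simp only: circle_norm_minus)
    qed (use ij * in blast)
  qed auto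
  finally show ?thesis by simp
qed

section \<open>Subpolynomial growth\<close>

text \<open>This is exactly the size of a loss that an exponent tending to 0 can absorb. Closure
  under sums and products spares all explicit forms of logarithms and divisor counts.\<close>

definition subpolynomial :: "(nat \<Rightarrow> real) \<Rightarrow> bool" where
  "subpolynomial u \<longleftrightarrow> (\<forall>\<epsilon>>0. \<exists>C. \<forall>N\<ge>1. \<bar>u N\<bar> \<le> C * real N powr \<epsilon>)"

lemma subpolynomialD:
  assumes "subpolynomial u" "\<epsilon> > 0"
  obtains C where "C > 0" "\<And>N. N \<ge> 1 \<Longrightarrow> \<bar>u N\<bar> \<le> C * real N powr \<epsilon>"
proof -
  obtain C where C: "\<And>N. N \<ge> 1 \<Longrightarrow> \<bar>u N\<bar> \<le> C * real N powr \<epsilon>"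
    using assms unfolding subpolynomial_def by blast
  have "\<bar>u N\<bar> \<le> (\<bar>C\<bar> + 1) * real N powr \<epsilon>" if "N \<ge> 1" for N
    by (rule order_trans[OF C[OF that]]) (intro mult_right_mono, auto)
  then show ?thesis using that[of "\<bar>C\<bar> + 1"] by auto
qed

lemma subpolynomial_const [simp]: "subpolynomial (\<lambda>_. c)"
  unfolding subpolynomial_def
proof (intro allI impI exI)
  fix \<epsilon> :: real and N :: nat assume "\<epsilon> > 0" "N \<ge> 1"
  then have "1 \<le> real N powr \<epsilon>" by (intro ge_one_powr_ge_zero) auto
  then show "\<bar>c\<bar> \<le> \<bar>c\<bar> * real N powr \<epsilon>" using mult_left_mono[of 1 "real N powr \<epsilon>" "\<bar>c\<bar>"] by simp
qed

lemma subpolynomial_mono: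
  assumes "subpolynomial v" "\<And>N. N \<ge> 1 \<Longrightarrow> \<bar>u N\<bar> \<le> \<bar>v N\<bar>"
  shows "subpolynomial u"
  using assms unfolding subpolynomial_def by (meson order_trans)

lemma subpolynomial_add:
  assumes "subpolynomial u" "subpolynomial v"
  shows "subpolynomial (\<lambda>N. u N + v N)"
  unfolding subpolynomial_def
proof (intro allI impI)
  fix \<epsilon> :: real assume eps: "\<epsilon> > 0"
  obtain C where C: "\<And>N. N \<ge> 1 \<Longrightarrow> \<bar>u N\<bar> \<le> C * real N powr \<epsilon>"
    by (rule subpolynomialD[OF assms(1) eps]) blast
  obtain D where D: "\<And>N. N \<ge> 1 \<Longrightarrow> \<bar>v N\<bar> \<le> D * real N powr \<epsilon>"
    by (rule subpolynomialD[OF assms(2) eps]) blast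
  have "\<bar>u N + v N\<bar> \<le> (C + D) * real N powr \<epsilon>" if "N \<ge> 1" for N
    using C[OF that] D[OF that] by (simp add: distrib_right)
  then show "\<exists>C. \<forall>N\<ge>1. \<bar>u N + v N\<bar> \<le> C * real N powr \<epsilon>" by blast
qed

lemma subpolynomial_mult:
  assumes "subpolynomial u" "subpolynomial v"
  shows "subpolynomial (\<lambda>N. u N * v N)"
  unfolding subpolynomial_def
proof (intro allI impI)
  fix \<epsilon> :: real assume "\<epsilon> > 0"
  then have eps: "\<epsilon> / 2 > 0" by simp
  obtain C where C: "C > 0" "\<And>N. N \<ge> 1 \<Longrightarrow> \<bar>u N\<bar> \<le> C * real N powr (\<epsilon> / 2)"
    by (rule subpolynomialD[OF assms(1) eps]) blast
  obtain D where D: "D > 0" "\<And>N. N \<ge> 1 \<Longrightarrow> \<bar>v N\<bar> \<le> D * real N powr (\<epsilon> / 2)"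
    by (rule subpolynomialD[OF assms(2) eps]) blast
  have "\<bar>u N * v N\<bar> \<le> (C * D) * real N powr \<epsilon>" if N: "N \<ge> 1" for N
  proof -
    have "\<bar>u N * v N\<bar> \<le> (C * real N powr (\<epsilon> / 2)) * (D * real N powr (\<epsilon> / 2))"
      unfolding abs_mult using C D N by (intro mult_mono) auto
    also have "\<dots> = (C * D) * real N powr (\<epsilon> / 2 + \<epsilon> / 2)"
      unfolding powr_add by (simp only: mult_ac)
    finally show ?thesis by simp
  qed
  then show "\<exists>C. \<forall>N\<ge>1. \<bar>u N * v N\<bar> \<le> C * real N powr \<epsilon>" by blast
qed

lemma subpolynomial_power: "subpolynomial u \<Longrightarrow> subpolynomial (\<lambda>N. u N ^ p)"
  by (induction p) (auto intro: subpolynomial_mult)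

lemma subpolynomial_sum:
  "(\<And>i. i \<in> A \<Longrightarrow> subpolynomial (u i)) \<Longrightarrow> subpolynomial (\<lambda>N. \<Sum>i\<in>A. u i N)"
  by (induction A rule: infinite_finite_induct) (auto intro: subpolynomial_add)

lemma subpolynomial_ln_power:
  assumes c: "c \<ge> 0"
  shows "subpolynomial (\<lambda>N. ln (1 + c * real N ^ p))"
proof -
  have "subpolynomial (\<lambda>N. ln (real N))"
    unfolding subpolynomial_def
  proof (intro allI impI exI)
    fix \<epsilon> :: real and N :: nat assume "\<epsilon> > 0" "N \<ge> 1"
    then show "\<bar>ln (real N)\<bar> \<le> (1 / \<epsilon>) * real N powr \<epsilon>"
      using ln_powr_bound[of N \<epsilon>] by simp
  qed
  then have "subpolynomial (\<lambda>N. ln (1 + c) + p * ln (real N))"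
    by (intro subpolynomial_add subpolynomial_mult) auto
  then show ?thesis
  proof (rule subpolynomial_mono)
    fix N :: nat assume N: "N \<ge> 1"
    have "1 + c * real N ^ p \<le> (1 + c) * real N ^ p"
      using N by (simp add: distrib_right)
    then have "ln (1 + c * real N ^ p) \<le> ln ((1 + c) * real N ^ p)"
      using c N by (intro ln_mono) (auto intro: add_pos_nonneg)
    also have "\<dots> = ln (1 + c) + p * ln (real N)"
      using c N by (simp add: ln_mult ln_realpow)
    finally show "\<bar>ln (1 + c * real N ^ p)\<bar> \<le> \<bar>ln (1 + c) + p * ln (real N)\<bar>"
      using c by simp
  qed
qed

text \<open>Turns the bound on the divisor function for all m \<le> n into one number, so that the
  divisor factor becomes a function of N. The inserted 0 keeps \<open>Max\<close> meaningful for n =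
  0.\<close>

definition max_divisor_count :: "nat \<Rightarrow> nat" where
  "max_divisor_count n = Max (insert 0 ((\<lambda>m. card {h. h dvd m}) ` {1..n}))"

lemma card_divisors_le_max_divisor_count:
  "0 < m \<Longrightarrow> m \<le> n \<Longrightarrow> card {h. h dvd m} \<le> max_divisor_count n"
  unfolding max_divisor_count_def by (intro Max_ge) auto

lemma subpolynomial_max_divisor_count: "subpolynomial (\<lambda>N. max_divisor_count (N ^ r))"
  unfolding subpolynomial_def
proof (intro allI impI)
  fix \<epsilon> :: real assume eps: "\<epsilon> > 0"
  \<comment> \<open>The exponent is shared among the r powers of N; \<open>Suc r\<close> instead of
    r avoids a division by 0 when r = 0.\<close>
  define \<epsilon>' where "\<epsilon>' = \<epsilon> / Suc r"
  have eps': "\<epsilon>' > 0" using eps by (simp add: \<epsilon>'_def)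
  obtain C where C: "C > 0" "\<And>n::nat. n > 0 \<Longrightarrow> card {h. h dvd n} \<le> C * n powr \<epsilon>'"
    using card_divisors_subpolynomial[OF eps'] by blast
  have "\<bar>real (max_divisor_count (N ^ r))\<bar> \<le> C * real N powr \<epsilon>" if N: "N \<ge> 1" for N
  proof -
    have "max_divisor_count (N ^ r) \<in> insert 0 ((\<lambda>m. card {h. h dvd m}) ` {1..N^r})"
      unfolding max_divisor_count_def by (intro Max_in) auto
    then have "max_divisor_count (N ^ r) = 0 \<or> (\<exists>m\<in>{1..N^r}. max_divisor_count (N ^ r) = card {h. h dvd m})"
      by (simp only: insert_iff image_iff)
    then show ?thesis
    proof (elim disjE bexE)
      fix m assume 2: "m \<in> {1..N^r}" "max_divisor_count (N ^ r) = card {h. h dvd m}"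
      have "real (max_divisor_count (N ^ r)) \<le> C * m powr \<epsilon>'" using 2 C by auto
      also have "real m \<le> real N ^ r" using 2 by (metis atLeastAtMost_iff of_nat_le_iff of_nat_power)
      then have "C * m powr \<epsilon>' \<le> C * (real N ^ r) powr \<epsilon>'"
        using C eps' by (intro mult_left_mono powr_mono2) auto
      also have "(real N ^ r) powr \<epsilon>' = real N powr (r * \<epsilon>')"
        using N by (simp add: powr_powr flip: powr_realpow)
      also have "C * real N powr (r * \<epsilon>') \<le> C * real N powr \<epsilon>"
        using C N eps by (intro mult_left_mono powr_mono) (auto simp: \<epsilon>'_def field_simps)
      finally show ?thesis by simp
    qed (use C in simp)
  qed
  then show "\<exists>C. \<forall>N\<ge>1. \<bar>real (max_divisor_count (N ^ r))\<bar> \<le> C * real N powr \<epsilon>" by blast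
qed

section \<open>Polynomial phases of orbits\<close>

lemma poly_seq_add:
  "poly_seq r \<theta> f \<Longrightarrow> poly_seq r \<theta>' g \<Longrightarrow> poly_seq r (\<theta> + \<theta>') (\<lambda>n. f n + g n)"
proof (induction r arbitrary: \<theta> \<theta>' f g)
  case (Suc r)
  show ?case unfolding poly_seq.simps
  proof
    fix h
    have "poly_seq r (circle_int_mult (int h) \<theta> + circle_int_mult (int h) \<theta>')
        (\<lambda>n. (f (n + h) - f n) + (g (n + h) - g n))"
      using Suc.prems unfolding poly_seq.simps by (intro Suc.IH) blast+
    then show "poly_seq r (circle_int_mult (int h) (\<theta> + \<theta>')) (\<lambda>n. f (n + h) + g (n + h) - (f n + g n))"
      by (simp add: circle_int_mult_add_right algebra_simps)
  qed
qed simp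

lemma poly_seq_zero: "poly_seq r 0 (\<lambda>_. 0)"
  by (induction r) auto

lemma poly_seq_sum:
  "(\<And>i. i \<in> A \<Longrightarrow> poly_seq r (\<theta> i) (f i)) \<Longrightarrow> poly_seq r (\<Sum>i\<in>A. \<theta> i) (\<lambda>n. \<Sum>i\<in>A. f i n)"
  by (induction A rule: infinite_finite_induct) (auto intro: poly_seq_add poly_seq_zero)

lemma poly_seq_shift: "poly_seq r \<theta> f \<Longrightarrow> poly_seq r \<theta> (\<lambda>n. f (n + m))"
proof (induction r arbitrary: \<theta> f)
  case (Suc r)
  show ?case unfolding poly_seq.simps
  proof
    fix h
    have "poly_seq r (circle_int_mult (int h) \<theta>) (\<lambda>n. f ((n + m) + h) - f (n + m))"
      using Suc.prems Suc.IH[of _ "\<lambda>n. f (n + h) - f n"] unfolding poly_seq.simps by blast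
    then show "poly_seq r (circle_int_mult (int h) \<theta>) (\<lambda>n. f (n + h + m) - f (n + m))"
      by (simp add: add_ac)
  qed
qed simp

lemma poly_seq_int_mult:
  "poly_seq r \<theta> f \<Longrightarrow> poly_seq r (circle_int_mult k \<theta>) (\<lambda>n. circle_int_mult k (f n))"
proof (induction r arbitrary: \<theta> f)
  case (Suc r)
  show ?case unfolding poly_seq.simps
  proof
    fix h
    have "poly_seq r (circle_int_mult k (circle_int_mult (int h) \<theta>)) (\<lambda>n. circle_int_mult k (f (n + h) - f n))"
      using Suc.prems Suc.IH unfolding poly_seq.simps by blast
    then show "poly_seq r (circle_int_mult (int h) (circle_int_mult k \<theta>))
        (\<lambda>n. circle_int_mult k (f (n + h)) - circle_int_mult k (f n))"
      by (simp add: circle_int_mult_diff_right circle_int_mult_assoc mult.commute)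
  qed
qed simp

text \<open>A polynomial of degree r is one of formal degree r + 1 with vanishing leading
  coefficient. This allows phases of different degrees to be added.\<close>

lemma poly_seq_Suc_zero: "poly_seq r \<theta> f \<Longrightarrow> poly_seq (Suc r) 0 f"
proof (induction r arbitrary: \<theta> f)
  case (Suc r)
  show ?case unfolding poly_seq.simps(2)[of "Suc r"]
  proof
    fix h
    show "poly_seq (Suc r) (circle_int_mult (int h) 0) (\<lambda>n. f (n + h) - f n)"
      using Suc.prems Suc.IH unfolding poly_seq.simps(2)[of r \<theta>] circle_int_mult_0_right by blast
  qed
qed simp

lemma poly_seq_less_zero:
  assumes "poly_seq r \<theta> f" "r < s"
  shows "poly_seq s 0 f"
proof -
  have "poly_seq (Suc (r + t)) 0 f" for t
    by (induction t) (metis add_0_right poly_seq_Suc_zero assms(1), metis add_Suc_right poly_seq_Suc_zero)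
  from this[of "s - Suc r"] show ?thesis using assms(2) by simp
qed

text \<open>Discrete integration: f(n + h) - f(n) is a sum of h shifts of \<open>g\<close>, whose
  leading coefficients add up to h \<theta>. Because \<theta> is the leading coefficient times a
  factorial, summation leaves it unchanged.\<close>

lemma poly_seq_Suc_increment:
  assumes g: "poly_seq r \<theta> g" and f: "\<And>n. f (Suc n) = f n + g n"
  shows "poly_seq (Suc r) \<theta> f"
  unfolding poly_seq.simps
proof
  fix h
  have "f (n + h) - f n = (\<Sum>m<h. g (n + m))" for n
    by (induction h) (simp_all add: f algebra_simps)
  moreover have "(\<Sum>m<h. \<theta>) = circle_int_mult (int h) \<theta>"
    by (induction h) (simp_all add: circle_int_mult_add_left add.commute)
  ultimately show "poly_seq r (circle_int_mult (int h) \<theta>) (\<lambda>n. f (n + h) - f n)"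
    using poly_seq_sum[of "{..<h}" r "\<lambda>_. \<theta>" "\<lambda>m n. g (n + m)"] poly_seq_shift[OF g] by simp
qed

lemma skew_product_apply:
  "j < d \<Longrightarrow> skew_product d \<omega> x j = (if Suc j < d then x j + x (Suc j) else x j + \<omega>)"
  by (simp add: skew_product_def)

text \<open>The last coordinate increases by \<omega> at every step, and every other coordinate by
  the current value of its successor. Counted from the end, each coordinate therefore gains one
  degree by discrete integration, always with the same \<omega>.\<close>

lemma poly_seq_orbit_coordinate:
  "i < d \<Longrightarrow> poly_seq (Suc i) \<omega> (\<lambda>n. (skew_product d \<omega> ^^ n) x (d - Suc i))"
proof (induction i)
  case 0
  have "poly_seq 0 \<omega> (\<lambda>_. \<omega>)" by simp
  then show ?case
    by (rule poly_seq_Suc_increment) (use 0 in \<open>simp add: skew_product_apply\<close>)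
next
  case (Suc i)
  have eq: "Suc (d - Suc (Suc i)) = d - Suc i" using Suc.prems by simp
  from Suc have "poly_seq (Suc i) \<omega> (\<lambda>n. (skew_product d \<omega> ^^ n) x (d - Suc i))" by simp
  then show ?case
    by (rule poly_seq_Suc_increment) (use Suc.prems in \<open>simp add: skew_product_apply eq\<close>)
qed

definition torus_phase :: "nat \<Rightarrow> (nat \<Rightarrow> int) \<Rightarrow> (nat \<Rightarrow> circle) \<Rightarrow> circle" where
  "torus_phase d k x = (\<Sum>j<d. circle_int_mult (k j) (x j))"

text \<open>Degrees decrease with the index of the coordinate, so the first coordinate with nonzero
  frequency dominates: later ones enter with leading coefficient 0 and no cancellation of k_i
  \<omega> can occur.\<close>

lemma poly_seq_orbit_phase:
  assumes i: "i < d" and k: "\<And>j. j < i \<Longrightarrow> k j = 0"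
  shows "poly_seq (d - i) (circle_int_mult (k i) \<omega>) (\<lambda>n. torus_phase d k ((skew_product d \<omega> ^^ n) x))"
proof -
  have "poly_seq (d - i) (if j = i then circle_int_mult (k i) \<omega> else 0)
      (\<lambda>n. circle_int_mult (k j) ((skew_product d \<omega> ^^ n) x j))" if j: "j < d" for j
  proof -
    have "poly_seq (Suc (d - Suc j)) \<omega> (\<lambda>n. (skew_product d \<omega> ^^ n) x (d - Suc (d - Suc j)))"
      using j by (intro poly_seq_orbit_coordinate) auto
    then have *: "poly_seq (d - j) \<omega> (\<lambda>n. (skew_product d \<omega> ^^ n) x j)"
      using j by (simp add: Suc_diff_Suc)
    consider "j < i" | "j = i" | "i < j" by linarith
    then show ?thesis
    proof cases
      case 1
      then show ?thesis using k by (simp add: poly_seq_zero)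
    next
      case 2
      then show ?thesis using poly_seq_int_mult[OF *] by simp
    next
      case 3
      then show ?thesis using poly_seq_less_zero[OF poly_seq_int_mult[OF *], of "d - i"] i j by simp
    qed
  qed
  then have "poly_seq (d - i) (\<Sum>j<d. if j = i then circle_int_mult (k i) \<omega> else 0)
      (\<lambda>n. \<Sum>j<d. circle_int_mult (k j) ((skew_product d \<omega> ^^ n) x j))"
    by (intro poly_seq_sum) auto
  then show ?thesis using i by (simp add: torus_phase_def)
qed

section \<open>Exponential sums along orbits\<close>

definition diophantine :: "real \<Rightarrow> circle \<Rightarrow> bool" where
  "diophantine \<gamma> \<omega> \<longleftrightarrow> (\<forall>k :: int. k \<noteq> 0 \<longrightarrow>
     circle_norm (circle_int_mult k \<omega>) \<ge> \<gamma> / (\<bar>k\<bar> * (ln (\<bar>k\<bar> + 1))\<^sup>2))"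

text \<open>The denominator of the Diophantine bound increases with |k|, so an upper bound for |k|
  suffices; this matters for products j k.\<close>

lemma diophantine_lower_bound:
  assumes "diophantine \<gamma> \<omega>" "\<gamma> > 0" "k \<noteq> 0" "real_of_int \<bar>k\<bar> \<le> M"
  shows "circle_norm (circle_int_mult k \<omega>) \<ge> \<gamma> / (M * (ln (M + 1))\<^sup>2)"
proof -
  have k: "real_of_int \<bar>k\<bar> \<ge> 1" using assms(3) by linarith
  have "\<gamma> / (M * (ln (M + 1))\<^sup>2) \<le> \<gamma> / (real_of_int \<bar>k\<bar> * (ln (real_of_int \<bar>k\<bar> + 1))\<^sup>2)"
    using k assms by (intro divide_left_mono mult_mono power_mono mult_pos_pos) auto
  also have "\<dots> \<le> circle_norm (circle_int_mult k \<omega>)"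
    using assms unfolding diophantine_def by auto
  finally show ?thesis .
qed

text \<open>With \<theta> = k \<omega> and |k| \<le> m, the multiples j \<theta>, j < N, are j k
  \<omega> with |j k| \<le> N m, so they are separated by \<kappa> of order 1 / (N m) up to
  logarithms. A block of N multiples then costs about N m, and N^(r-1) blocks give N^r m. For r = 0
  the majorant is a single reciprocal distance, of order m up to logarithms.\<close>

lemma weyl_majorant_diophantine:
  fixes \<gamma> :: real
  assumes \<gamma>: "\<gamma> > 0"
  shows "\<exists>U. subpolynomial U \<and> (\<forall>\<omega> N m k. diophantine \<gamma> \<omega> \<longrightarrow> 1 \<le> m \<longrightarrow> m \<le> N \<longrightarrow> k \<noteq> 0 \<longrightarrow> \<bar>k\<bar> \<le> int m \<longrightarrow>
      weyl_majorant N r (circle_int_mult k \<omega>) / N ^ Suc r \<le> U N * (m / N))"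
proof (cases r)
  case 0
  let ?U = "\<lambda>N. (ln (1 + 1 * real N ^ 1))\<^sup>2 * (1 / \<gamma>)"
  have "subpolynomial ?U"
    by (intro subpolynomial_mult subpolynomial_power subpolynomial_ln_power subpolynomial_const) auto
  moreover have "recip_cap N (circle_int_mult k \<omega>) / N \<le> ?U N * (m / N)"
    if \<omega>: "diophantine \<gamma> \<omega>" and m: "1 \<le> m" "m \<le> N" and k: "k \<noteq> 0" "\<bar>k\<bar> \<le> int m" for \<omega> N m k
  proof -
    have pos: "0 < \<gamma> / (m * (ln (real m + 1))\<^sup>2)" using \<gamma> m by simp
    have "\<gamma> / (m * (ln (real m + 1))\<^sup>2) \<le> circle_norm (circle_int_mult k \<omega>)"
      using \<omega> \<gamma> k by (intro diophantine_lower_bound) linarith+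
    then have "1 / circle_norm (circle_int_mult k \<omega>) \<le> 1 / (\<gamma> / (m * (ln (real m + 1))\<^sup>2))"
      using pos by (intro divide_left_mono mult_pos_pos) auto
    also have "\<dots> = (ln (real m + 1))\<^sup>2 * (1 / \<gamma>) * m" using \<gamma> by (simp add: field_simps)
    also have "\<dots> \<le> ?U N * m"
      using m \<gamma> by (intro mult_right_mono power_mono) (auto simp: add.commute)
    finally have "1 / circle_norm (circle_int_mult k \<omega>) \<le> ?U N * m" .
    moreover have "recip_cap N (circle_int_mult k \<omega>) \<le> 1 / circle_norm (circle_int_mult k \<omega>)"
      using pos \<open>_ \<le> circle_norm _\<close> by (intro recip_cap_le_inverse) linarith
    ultimately have "recip_cap N (circle_int_mult k \<omega>) / N \<le> ?U N * m / N"
      by (intro divide_right_mono) auto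
    then show ?thesis by simp
  qed
  ultimately show ?thesis using 0 by (intro exI[of _ ?U]) auto
next
  case (Suc s)
  \<comment> \<open>Since m \<le> N, this dominates ln(N m + 1) and depends on N alone; the written
    form is that of \<open>subpolynomial_ln_power\<close>.\<close>
  define \<Lambda> where "\<Lambda> N = ln (1 + 1 * real N ^ 2)" for N
  \<comment> \<open>The sixth power comes from 1 / \<kappa> = N m \<Lambda>^2 / \<gamma> \<le> N^2
    (N^2)^2 / \<gamma>, using the crude \<Lambda> \<le> N^2, which is affordable inside a
    logarithm.\<close>
  define V where "V N = 2 * (1 + (1 + ln (1 + (1 / \<gamma>) * real N ^ 6)) * ((\<Lambda> N)\<^sup>2 * (1 / \<gamma>)))" for N
  define U where "U N = real (max_divisor_count (N ^ r)) ^ r * V N" for N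
  have "subpolynomial U"
    unfolding U_def V_def \<Lambda>_def using \<gamma>
    by (intro subpolynomial_mult subpolynomial_add subpolynomial_power subpolynomial_ln_power
        subpolynomial_const subpolynomial_max_divisor_count) auto
  moreover have "weyl_majorant N r (circle_int_mult k \<omega>) / N ^ Suc r \<le> U N * (m / N)"
    if \<omega>: "diophantine \<gamma> \<omega>" and m: "1 \<le> m" "m \<le> N" and k: "k \<noteq> 0" "\<bar>k\<bar> \<le> int m" for \<omega> N m k
  proof -
    define \<theta> where "\<theta> = circle_int_mult k \<omega>"
    have N: "N > 0" using m by simp
    have NN: "1 \<le> real N" using N by simp
    define \<kappa> where "\<kappa> = \<gamma> / (real N * m * (\<Lambda> N)\<^sup>2)"
    have \<Lambda>0: "\<Lambda> N > 0" unfolding \<Lambda>_def using N by (intro ln_gt_zero) auto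
    have \<Lambda>2: "\<Lambda> N \<le> real N ^ 2" unfolding \<Lambda>_def using ln_add_one_self_le_self[of "real N ^ 2"] by simp
    have \<kappa>: "\<kappa> > 0" using \<gamma> \<Lambda>0 m by (simp add: \<kappa>_def)
    have mN: "real N * m \<le> real N ^ 2" using m N by (simp add: power2_eq_square)
    have ln_le: "0 < ln (real N * m + 1)" "ln (real N * m + 1) \<le> \<Lambda> N"
    proof -
      have "0 < real N * m" using m N by simp
      then show "0 < ln (real N * m + 1)" by (intro ln_gt_zero) linarith
      show "ln (real N * m + 1) \<le> \<Lambda> N"
        unfolding \<Lambda>_def using mN \<open>0 < real N * m\<close> by (intro ln_mono) linarith+
    qed
    have sep: "circle_norm (circle_int_mult (int j) \<theta>) \<ge> \<kappa>" if j: "0 < j" "j < N" for j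
    proof -
      have "\<kappa> \<le> \<gamma> / ((real N * m) * (ln (real N * m + 1))\<^sup>2)"
        unfolding \<kappa>_def using ln_le \<Lambda>0 m N \<gamma>
        by (intro divide_left_mono mult_left_mono power_mono mult_pos_pos zero_less_power) auto
      also have "\<dots> \<le> circle_norm (circle_int_mult (int j * k) \<omega>)"
      proof (rule diophantine_lower_bound[OF \<omega> \<gamma>])
        have "\<bar>int j * k\<bar> \<le> int N * int m" unfolding abs_mult using j k by (intro mult_mono) auto
        then show "real_of_int \<bar>int j * k\<bar> \<le> real N * m"
          by (metis of_int_le_iff of_int_mult of_int_of_nat_eq)
      qed (use j k in auto)
      finally show ?thesis by (simp add: \<theta>_def circle_int_mult_assoc)
    qed
    have inv\<kappa>: "1 / \<kappa> = real N * m * ((\<Lambda> N)\<^sup>2 * (1 / \<gamma>))"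
      using \<gamma> by (simp add: \<kappa>_def)
    also have "\<dots> \<le> real N ^ 2 * ((real N ^ 2)\<^sup>2 * (1 / \<gamma>))"
      using mN \<Lambda>0 \<Lambda>2 \<gamma> by (intro mult_mono power_mono) auto
    also have "\<dots> = (1 / \<gamma>) * real N ^ 6" by (simp flip: power_mult power_add)
    finally have "ln (1 + 1 / \<kappa>) \<le> ln (1 + (1 / \<gamma>) * real N ^ 6)"
      using \<kappa> by (intro ln_mono) (auto intro: add_pos_pos)
    then have "2 * (N + (1 + ln (1 + 1 / \<kappa>)) / \<kappa>)
        \<le> 2 * (real N * m + (1 + ln (1 + (1 / \<gamma>) * real N ^ 6)) * (1 / \<kappa>))"
      using \<kappa> m N by (auto intro!: add_mono divide_right_mono)
    also have "\<dots> = real N * m * V N"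
      unfolding inv\<kappa> V_def by (simp add: algebra_simps add_divide_distrib)
    finally have block: "2 * (N + (1 + ln (1 + 1 / \<kappa>)) / \<kappa>) \<le> real N * m * V N" .
    have "weyl_majorant N r \<theta> \<le> real (max_divisor_count (N ^ r)) ^ r * (\<Sum>l=1..N^r. recip_cap N (circle_int_mult (int l) \<theta>))"
      using N by (intro weyl_majorant_le) (auto intro: card_divisors_le_max_divisor_count)
    also have "N ^ r = N ^ s * N" using Suc by simp
    also have "real (max_divisor_count (N ^ s * N)) ^ r * (\<Sum>l=1..N^s*N. recip_cap N (circle_int_mult (int l) \<theta>))
        \<le> real (max_divisor_count (N ^ s * N)) ^ r * (real (N ^ s) * (real N * m * V N))"
    proof (intro mult_left_mono)
      have "(\<Sum>l=1..N^s*N. recip_cap N (circle_int_mult (int l) \<theta>))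
          \<le> real (N ^ s) * (2 * (N + (1 + ln (1 + 1 / \<kappa>)) / \<kappa>))"
        using \<kappa> N sep by (rule sum_recip_cap_multiples_le)
      also have "\<dots> \<le> real (N ^ s) * (real N * m * V N)"
        using block by (intro mult_left_mono) auto
      finally show "(\<Sum>l=1..N^s*N. recip_cap N (circle_int_mult (int l) \<theta>)) \<le> real (N ^ s) * (real N * m * V N)" .
    qed auto
    also have "\<dots> = U N * (m / N) * N ^ Suc r"
      using N Suc by (simp add: U_def mult_ac)
    finally show ?thesis using N unfolding \<theta>_def by (simp add: pos_divide_le_eq)
  qed
  ultimately show ?thesis by blast
qed

text \<open>A frequency with i leading zeros has a phase of degree d - i and satisfies the bound
  with the smaller power 2^(d-1-i). The average is at most 1, so passing to the power 2^(d-1) only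
  decreases it and one exponent serves all frequencies. The normalisation U \<ge> 1 later allows
  U^\<delta> to be replaced by U.\<close>

lemma exponential_sum_skew_product:
  fixes \<gamma> :: real and d :: nat
  assumes \<gamma>: "\<gamma> > 0"
  shows "\<exists>U. subpolynomial U \<and> (\<forall>N. U N \<ge> 1) \<and> (\<forall>\<omega> N m k x. diophantine \<gamma> \<omega> \<longrightarrow> 1 \<le> m \<longrightarrow> m \<le> N \<longrightarrow>
      (\<forall>j<d. \<bar>k j\<bar> \<le> int m) \<longrightarrow> (\<exists>j<d. k j \<noteq> 0) \<longrightarrow>
      (norm (\<Sum>n<N. circle_char (torus_phase d k ((skew_product d \<omega> ^^ n) x))) / N) ^ (2 ^ (d - 1)) \<le> U N * (m / N))"
proof -
  have "\<exists>U. subpolynomial U \<and> (\<forall>\<omega> N m k. diophantine \<gamma> \<omega> \<longrightarrow> 1 \<le> m \<longrightarrow> m \<le> N \<longrightarrow> k \<noteq> 0 \<longrightarrow> \<bar>k\<bar> \<le> int m \<longrightarrow>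
      weyl_majorant N r (circle_int_mult k \<omega>) / N ^ Suc r \<le> U N * (m / N))" for r
    by (rule weyl_majorant_diophantine[OF \<gamma>])
  then obtain U where U: "\<And>r. subpolynomial (U r)"
    and maj: "\<And>r \<omega> N m k. diophantine \<gamma> \<omega> \<Longrightarrow> 1 \<le> m \<Longrightarrow> m \<le> N \<Longrightarrow> k \<noteq> 0 \<Longrightarrow> \<bar>k\<bar> \<le> int m \<Longrightarrow>
      weyl_majorant N r (circle_int_mult k \<omega>) / N ^ Suc r \<le> U r N * (m / N)"
    by metis
  obtain C where C: "\<And>r. C r > 0" and weyl: "\<And>r N b f \<theta>. N > 0 \<Longrightarrow> b \<le> N \<Longrightarrow> poly_seq (Suc r) \<theta> f \<Longrightarrow>
     (norm (\<Sum>n<b. circle_char (f n)) / N) ^ (2 ^ r) \<le> C r * (1 / N + weyl_majorant N r \<theta> / N ^ Suc r)"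
    using weyl_differencing by metis
  define W where "W N = 1 + (\<Sum>r<d. C r * (1 + \<bar>U r N\<bar>))" for N
  have W1: "W N \<ge> 1" for N
    using sum_nonneg[of "{..<d}" "\<lambda>r. C r * (1 + \<bar>U r N\<bar>)"] less_imp_le[OF C] by (simp add: W_def)
  have "subpolynomial (\<lambda>N. \<bar>U r N\<bar>)" for r
    by (rule subpolynomial_mono[OF U[of r]]) simp
  then have "subpolynomial W"
    unfolding W_def by (intro subpolynomial_add subpolynomial_sum subpolynomial_mult) auto
  moreover have "(norm (\<Sum>n<N. circle_char (torus_phase d k ((skew_product d \<omega> ^^ n) x))) / N) ^ (2 ^ (d - 1)) \<le> W N * (m / N)"
    if \<omega>: "diophantine \<gamma> \<omega>" and m: "1 \<le> m" "m \<le> N" and k: "\<forall>j<d. \<bar>k j\<bar> \<le> int m" "\<exists>j<d. k j \<noteq> 0" for \<omega> N m k x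
  proof -
    define A where "A = norm (\<Sum>n<N. circle_char (torus_phase d k ((skew_product d \<omega> ^^ n) x))) / N"
    have N: "N > 0" using m by simp
    define i where "i = (LEAST j. j < d \<and> k j \<noteq> 0)"
    have i: "i < d" "k i \<noteq> 0" using LeastI_ex[of "\<lambda>j. j < d \<and> k j \<noteq> 0"] k(2) by (auto simp: i_def)
    have min: "k j = 0" if "j < i" for j
      using not_less_Least[of j "\<lambda>j. j < d \<and> k j \<noteq> 0"] that i by (auto simp: i_def)
    define r where "r = d - 1 - i"
    have r: "Suc r = d - i" "r < d" "r \<le> d - 1" using i by (auto simp: r_def)
    have A0: "A \<ge> 0" by (simp add: A_def)
    have "norm (\<Sum>n<N. circle_char (torus_phase d k ((skew_product d \<omega> ^^ n) x))) \<le> (\<Sum>n<N. 1)"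
      by (rule sum_norm_le) simp
    then have A1: "A \<le> 1" using N by (simp add: A_def)
    have "A ^ (2 ^ (d - 1)) \<le> A ^ (2 ^ r)"
      using A0 A1 r by (intro power_decreasing power_increasing) auto
    also have "\<dots> \<le> C r * (1 / N + weyl_majorant N r (circle_int_mult (k i) \<omega>) / N ^ Suc r)"
    proof -
      have "poly_seq (Suc r) (circle_int_mult (k i) \<omega>) (\<lambda>n. torus_phase d k ((skew_product d \<omega> ^^ n) x))"
        unfolding r(1) using i(1) min by (intro poly_seq_orbit_phase) auto
      from weyl[OF N order_refl this] show ?thesis
        unfolding A_def by (simp only: of_nat_power)
    qed
    also have "\<dots> \<le> C r * (m / N + \<bar>U r N\<bar> * (m / N))"
    proof (intro mult_left_mono add_mono)
      have "weyl_majorant N r (circle_int_mult (k i) \<omega>) / N ^ Suc r \<le> U r N * (m / N)"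
        using maj[OF \<omega> m] k i by auto
      also have "\<dots> \<le> \<bar>U r N\<bar> * (m / N)" by (intro mult_right_mono) auto
      finally show "weyl_majorant N r (circle_int_mult (k i) \<omega>) / N ^ Suc r \<le> \<bar>U r N\<bar> * (m / N)" .
    qed (use m C[of r] in \<open>auto intro: divide_right_mono\<close>)
    also have "\<dots> = C r * (1 + \<bar>U r N\<bar>) * (m / N)" by (simp add: algebra_simps add_divide_distrib)
    also have "\<dots> \<le> W N * (m / N)"
    proof (intro mult_right_mono)
      have "C r * (1 + \<bar>U r N\<bar>) \<le> (\<Sum>r<d. C r * (1 + \<bar>U r N\<bar>))"
        using C r by (intro member_le_sum[where f = "\<lambda>r. C r * (1 + \<bar>U r N\<bar>)"]) (auto intro: less_imp_le)
      then show "C r * (1 + \<bar>U r N\<bar>) \<le> W N" by (simp add: W_def)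
    qed auto
    finally show ?thesis by (simp add: A_def)
  qed
  ultimately show ?thesis using W1 by blast
qed

section \<open>Fejer means on a grid\<close>

text \<open>As a normalised square it is visibly nonnegative, and the bound for geometric sums
  controls its tail.\<close>

definition fejer :: "nat \<Rightarrow> circle \<Rightarrow> real" where
  "fejer M t = (norm (\<Sum>k<M. circle_char t ^ k))\<^sup>2 / M"

text \<open>For M > 0 this is max(0, 1 - |k| / M); the counting form is what expanding the square
  produces.\<close>

definition fejer_coeff :: "nat \<Rightarrow> int \<Rightarrow> real" where
  "fejer_coeff M k = card {(a, b) \<in> {..<M} \<times> {..<M}. int a - int b = k} / M"

lemma fejer_nonneg [simp]: "fejer M t \<ge> 0"
  by (simp add: fejer_def)

lemma fejer_coeff_nonneg [simp]: "fejer_coeff M k \<ge> 0"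
  by (simp add: fejer_coeff_def)

lemma fejer_coeff_le_1: "fejer_coeff M k \<le> 1"
proof -
  have "card {(a, b) \<in> {..<M} \<times> {..<M}. int a - int b = k} \<le> card {..<M}"
    by (rule card_inj_on_le[where f = fst]) (auto simp: inj_on_def)
  then show ?thesis by (cases "M = 0") (auto simp: fejer_coeff_def)
qed

lemma fejer_coeff_0: "M > 0 \<Longrightarrow> fejer_coeff M 0 = 1"
proof -
  assume M: "M > 0"
  have "{(a, b) \<in> {..<M} \<times> {..<M}. int a - int b = 0} = (\<lambda>a. (a, a)) ` {..<M}" by auto
  then have "card {(a, b) \<in> {..<M} \<times> {..<M}. int a - int b = 0} = M"
    by (simp add: card_image inj_on_def)
  with M show ?thesis by (simp add: fejer_coeff_def)
qed

lemma fejer_expansion: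
  "complex_of_real (fejer M t) = (\<Sum>k\<in>{-int M<..<int M}. fejer_coeff M k * circle_char (circle_int_mult k t))"
proof -
  let ?S = "{..<M} \<times> {..<M}"
  have "complex_of_real ((norm (\<Sum>k<M. circle_char t ^ k))\<^sup>2)
      = (\<Sum>a<M. circle_char t ^ a) * cnj (\<Sum>b<M. circle_char t ^ b)"
    by (rule complex_norm_square)
  also have "\<dots> = (\<Sum>(a, b)\<in>?S. circle_char (circle_int_mult (int a - int b) t))"
    by (simp add: sum_product sum.cartesian_product circle_int_mult_diff_left circle_char_diff circle_char_nat_mult)
  also have "\<dots> = (\<Sum>k\<in>{-int M<..<int M}. \<Sum>p\<in>{p \<in> ?S. (\<lambda>(a, b). int a - int b) p = k}.
      (\<lambda>(a, b). circle_char (circle_int_mult (int a - int b) t)) p)"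
    by (rule sum.group[symmetric]) auto
  also have "\<dots> = (\<Sum>k\<in>{-int M<..<int M}. \<Sum>p\<in>{p \<in> ?S. (\<lambda>(a, b). int a - int b) p = k}. circle_char (circle_int_mult k t))"
    by (intro sum.cong) auto
  also have "\<dots> = (\<Sum>k\<in>{-int M<..<int M}. of_nat (card {(a, b) \<in> ?S. int a - int b = k}) * circle_char (circle_int_mult k t))"
    by (auto intro!: sum.cong arg_cong[where f = card])
  finally show ?thesis
    by (simp add: fejer_def fejer_coeff_def sum_divide_distrib)
qed

text \<open>One of the two factors of the square absorbs the distance, as
  \<open>recip_cap M t * circle_norm t\<close> is at most 1. The other one remains, so the first
  moment of the kernel becomes a sum over separated points.\<close>

lemma fejer_mult_circle_norm_le: "fejer M t * circle_norm t \<le> recip_cap M t / M"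
proof -
  let ?s = "norm (\<Sum>k<M. circle_char t ^ k)"
  have s: "?s \<le> recip_cap M t" by (rule norm_sum_circle_char_power_le) simp
  have "recip_cap M t * circle_norm t \<le> 1"
    by (auto simp: recip_cap_def)
  have "?s\<^sup>2 * circle_norm t \<le> recip_cap M t * (recip_cap M t * circle_norm t)"
    using s by (auto simp: power2_eq_square mult.assoc intro!: mult_mono)
  also have "\<dots> \<le> recip_cap M t * 1"
    using \<open>_ \<le> 1\<close> by (intro mult_left_mono) auto
  finally show ?thesis by (simp add: fejer_def divide_right_mono)
qed

section \<open>Orthogonality and the Fejer kernel on the grid of the circle\<close>

definition grid_point :: "nat \<Rightarrow> nat \<Rightarrow> circle" where
  "grid_point Q y = to_circle (y / Q)"

lemma circle_norm_grid_diff: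
  assumes y: "y < Q" "y' < Q" "y \<noteq> y'"
  shows "circle_norm (grid_point Q y - grid_point Q y') \<ge> 1 / Q"
proof -
  define j where "j = int y - int y'"
  have j: "j \<noteq> 0" "\<bar>j\<bar> < int Q" using y by (auto simp: j_def)
  have Q: "Q > 0" using y by simp
  have "1 / real Q \<le> dist (j / Q) a" if a: "a \<in> \<int>" for a
  proof -
    obtain i where i: "a = of_int i" using a by (elim Ints_cases)
    have "j \<noteq> i * int Q"
    proof
      assume eq: "j = i * int Q"
      then have "i \<noteq> 0" using j by auto
      then have "int Q \<le> \<bar>i\<bar> * int Q" using Q by simp
      then show False using eq j by (simp add: abs_mult)
    qed
    then have "1 \<le> \<bar>real_of_int (j - i * int Q)\<bar>" by linarith
    then have "1 / real Q \<le> \<bar>real_of_int (j - i * int Q)\<bar> / Q" by (intro divide_right_mono) auto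
    also have "\<dots> = \<bar>real_of_int (j - i * int Q) / Q\<bar>" by simp
    also have "real_of_int (j - i * int Q) / Q = j / Q - a" using Q i by (simp add: field_simps)
    finally show ?thesis by (simp add: dist_real_def)
  qed
  moreover have "(\<int> :: real set) \<noteq> {}" by auto
  ultimately have "1 / real Q \<le> infdist (j / Q) \<int>"
    by (subst infdist_notempty) (auto intro!: cINF_greatest)
  then show ?thesis
    by (simp add: grid_point_def to_circle_diff circle_norm.abs_eq j_def diff_divide_distrib)
qed

text \<open>Orthogonality on Z/Q: z is a Q-th root of unity, and 0 < |k| < Q keeps it away from 1,
  so the geometric sum vanishes.\<close>

lemma sum_grid_circle_char:
  assumes k: "\<bar>k\<bar> < int Q"
  shows "(\<Sum>y<Q. circle_char (circle_int_mult k (grid_point Q y))) = (if k = 0 then of_nat Q else 0)"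
proof (cases "k = 0")
  case False
  have Q: "Q > 1" using k False by linarith
  then have pos: "1 / real Q > 0" by simp
  define z where "z = circle_char (circle_int_mult k (grid_point Q 1))"
  have pow: "circle_char (circle_int_mult k (grid_point Q y)) = z ^ y" for y
    unfolding z_def by (simp add: grid_point_def circle_int_mult_assoc mult.commute circle_int_mult.abs_eq
        flip: circle_char_nat_mult)
  have "z ^ Q = circle_char (to_circle (of_int k))"
    using Q by (simp add: pow[symmetric] grid_point_def circle_int_mult.abs_eq)
  also have "to_circle (of_int k) = 0" by (simp add: zero_circle_def circle.abs_eq_iff)
  finally have zQ: "z ^ Q = 1" by simp
  have "circle_norm (circle_int_mult k (grid_point Q 1)) \<noteq> 0"
  \<comment> \<open>Grid points carry natural indices, so k / Q is written as the difference of
    point |k| and point 0 in the order given by the sign of k.\<close>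
  proof (cases "k > 0")
    case True
    have "circle_int_mult k (grid_point Q 1) = grid_point Q (nat k) - grid_point Q 0"
      using True by (simp add: grid_point_def circle_int_mult.abs_eq to_circle_diff)
    moreover have "1 / real Q \<le> circle_norm (grid_point Q (nat k) - grid_point Q 0)"
      using True k Q by (intro circle_norm_grid_diff) auto
    ultimately show ?thesis using pos by (metis not_le)
  next
    case neg: False
    have "circle_int_mult k (grid_point Q 1) = grid_point Q 0 - grid_point Q (nat (- k))"
      using neg by (simp add: grid_point_def circle_int_mult.abs_eq to_circle_diff)
    moreover have "1 / real Q \<le> circle_norm (grid_point Q 0 - grid_point Q (nat (- k)))"
      using neg False k Q by (intro circle_norm_grid_diff) auto
    ultimately show ?thesis using pos by (metis not_le)
  qed
  then have "circle_norm (circle_int_mult k (grid_point Q 1)) > 0"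
    using circle_norm_nonneg[of "circle_int_mult k (grid_point Q 1)"] by linarith
  then have "z \<noteq> 1"
    using norm_circle_char_minus_1_ge[of "circle_int_mult k (grid_point Q 1)"] unfolding z_def by auto
  then show ?thesis using False zQ by (simp add: pow geometric_sum)
qed simp

text \<open>All frequencies of the kernel are below M \<le> Q, so the grid sees only the coefficient
  1 at frequency 0. The mass is exact and independent of the centre x.\<close>

lemma sum_grid_fejer:
  assumes "0 < M" "M \<le> Q"
  shows "(\<Sum>y<Q. fejer M (x - grid_point Q y)) = Q"
proof -
  have "complex_of_real (\<Sum>y<Q. fejer M (x - grid_point Q y))
      = (\<Sum>y<Q. \<Sum>k\<in>{-int M<..<int M}. fejer_coeff M k * circle_char (circle_int_mult k (x - grid_point Q y)))"
    by (simp add: fejer_expansion)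
  also have "\<dots> = (\<Sum>k\<in>{-int M<..<int M}. \<Sum>y<Q. fejer_coeff M k * circle_char (circle_int_mult k (x - grid_point Q y)))"
    by (rule sum.swap)
  also have "\<dots> = (\<Sum>k\<in>{-int M<..<int M}. fejer_coeff M k * circle_char (circle_int_mult k x) * cnj (\<Sum>y<Q. circle_char (circle_int_mult k (grid_point Q y))))"
    by (simp add: circle_int_mult_diff_right circle_char_diff sum_distrib_left mult.assoc)
  also have "\<dots> = (\<Sum>k\<in>{-int M<..<int M}. if k = 0 then of_nat Q else 0)"
  proof (intro sum.cong refl)
    fix k assume "k \<in> {-int M<..<int M}"
    then have "\<bar>k\<bar> < int Q" using assms by auto
    then show "fejer_coeff M k * circle_char (circle_int_mult k x) * cnj (\<Sum>y<Q. circle_char (circle_int_mult k (grid_point Q y)))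
        = (if k = 0 then of_nat Q else 0)"
      using assms by (simp only: sum_grid_circle_char) (simp add: fejer_coeff_0)
  qed
  also have "\<dots> = complex_of_real (real Q)" using assms by simp
  finally show ?thesis by (simp only: of_real_eq_iff)
qed

text \<open>The points x - y / (2M) are separated by 1 / (2M). Against the total mass 2M this makes
  the first moment of order log M / M, and here the logarithm of the smoothing error arises.\<close>

lemma sum_grid_fejer_circle_norm:
  assumes M: "0 < M"
  shows "(\<Sum>y<2*M. fejer M (x - grid_point (2*M) y) * circle_norm (x - grid_point (2*M) y)) \<le> 2 * (3 + 2 * ln (1 + 2 * real M))"
proof -
  let ?Q = "2 * M"
  have "(\<Sum>y<?Q. fejer M (x - grid_point ?Q y) * circle_norm (x - grid_point ?Q y))
      \<le> (\<Sum>y<?Q. recip_cap M (x - grid_point ?Q y) / M)"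
    by (intro sum_mono fejer_mult_circle_norm_le)
  also have "\<dots> = (\<Sum>y<?Q. recip_cap M (x - grid_point ?Q y)) / M"
    by (simp add: sum_divide_distrib)
  also have "\<dots> \<le> 2 * (M + (1 + ln (1 + 1 / (1 / ?Q))) / (1 / ?Q)) / M"
  proof (intro divide_right_mono sum_recip_cap_separated)
    fix i j assume ij: "i \<in> {..<?Q}" "j \<in> {..<?Q}" "i \<noteq> j"
    have "(x - grid_point ?Q i) - (x - grid_point ?Q j) = grid_point ?Q j - grid_point ?Q i" by simp
    then show "1 / ?Q \<le> circle_norm ((x - grid_point ?Q i) - (x - grid_point ?Q j))"
      using circle_norm_grid_diff[of j ?Q i] ij by simp
  qed (use M in auto)
  also have "\<dots> = 2 * (3 + 2 * ln (1 + 2 * real M))"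
    using M by (simp add: field_simps)
  finally show ?thesis .
qed

section \<open>The product kernel and Parseval on the grid of the torus\<close>

definition torus_grid :: "nat \<Rightarrow> nat \<Rightarrow> (nat \<Rightarrow> nat) set" where
  "torus_grid d Q = PiE {..<d} (\<lambda>_. {..<Q})"

definition torus_grid_point :: "nat \<Rightarrow> nat \<Rightarrow> (nat \<Rightarrow> nat) \<Rightarrow> nat \<Rightarrow> circle" where
  "torus_grid_point d Q y = (\<lambda>j\<in>{..<d}. grid_point Q (y j))"

definition torus_fejer :: "nat \<Rightarrow> nat \<Rightarrow> (nat \<Rightarrow> circle) \<Rightarrow> real" where
  "torus_fejer d M z = (\<Prod>j<d. fejer M (z j))"

definition freq_box :: "nat \<Rightarrow> nat \<Rightarrow> (nat \<Rightarrow> int) set" where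
  "freq_box d M = PiE {..<d} (\<lambda>_. {-int M<..<int M})"

lemma finite_torus_grid [simp]: "finite (torus_grid d Q)"
  by (simp add: torus_grid_def finite_PiE)

lemma card_torus_grid: "card (torus_grid d Q) = Q ^ d"
  by (simp add: torus_grid_def card_PiE)

lemma torus_grid_point_in_torus: "torus_grid_point d Q y \<in> torus d"
  by (simp add: torus_grid_point_def torus_def)

lemma finite_freq_box [simp]: "finite (freq_box d M)"
  by (simp add: freq_box_def finite_PiE)

lemma card_freq_box_le: "card (freq_box d M) \<le> (2 * M) ^ d"
proof -
  have "card (freq_box d M) = (nat (2 * int M - 1)) ^ d"
    by (simp add: freq_box_def card_PiE)
  also have "\<dots> \<le> (2 * M) ^ d"
    by (intro power_mono) auto
  finally show ?thesis .
qed

lemma torus_fejer_nonneg [simp]: "torus_fejer d M z \<ge> 0"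
  by (simp add: torus_fejer_def prod_nonneg)

lemma sum_torus_grid_fejer:
  assumes "0 < M" "M \<le> Q"
  shows "(\<Sum>y\<in>torus_grid d Q. torus_fejer d M (\<lambda>j. x j - grid_point Q (y j))) = real Q ^ d"
  unfolding torus_fejer_def torus_grid_def
  by (subst prod_sum_PiE[symmetric]) (auto simp: sum_grid_fejer[OF assms])

text \<open>Attaching the distance to the i-th factor alone keeps the summand a product over
  coordinates; all other factors sum to 2M exactly.\<close>

lemma sum_torus_grid_fejer_circle_norm:
  assumes M: "0 < M" and i: "i < d"
  shows "(\<Sum>y\<in>torus_grid d (2*M). torus_fejer d M (\<lambda>j. x j - grid_point (2*M) (y j)) * circle_norm (x i - grid_point (2*M) (y i)))
    \<le> real (2*M) ^ d * ((3 + 2 * ln (1 + 2 * real M)) / M)"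
proof -
  let ?Q = "2 * M"
  let ?f = "\<lambda>j y. fejer M (x j - grid_point ?Q y) * (if j = i then circle_norm (x j - grid_point ?Q y) else 1)"
  have "(\<Sum>y\<in>torus_grid d ?Q. torus_fejer d M (\<lambda>j. x j - grid_point ?Q (y j)) * circle_norm (x i - grid_point ?Q (y i)))
      = (\<Sum>y\<in>torus_grid d ?Q. \<Prod>j<d. ?f j (y j))"
    using i by (simp add: torus_fejer_def prod.distrib)
  also have "\<dots> = (\<Prod>j<d. \<Sum>y<?Q. ?f j y)"
    unfolding torus_grid_def by (rule prod_sum_PiE[symmetric]) auto
  also have "\<dots> = (\<Prod>j\<in>{..<d}. if j = i then (\<Sum>y<?Q. fejer M (x i - grid_point ?Q y) * circle_norm (x i - grid_point ?Q y)) else ?Q)"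
    using M by (intro prod.cong) (auto simp: sum_grid_fejer)
  also have "\<dots> = (\<Sum>y<?Q. fejer M (x i - grid_point ?Q y) * circle_norm (x i - grid_point ?Q y)) * (\<Prod>j\<in>{..<d} - {i}. real ?Q)"
    using i by (subst prod.remove[of _ i]) (auto intro!: prod.cong)
  also have "\<dots> \<le> 2 * (3 + 2 * ln (1 + 2 * real M)) * (\<Prod>j\<in>{..<d} - {i}. real ?Q)"
    by (intro mult_right_mono sum_grid_fejer_circle_norm M prod_nonneg) auto
  also have "(\<Prod>j\<in>{..<d} - {i}. real ?Q) = real ?Q ^ (d - 1)"
    using i by simp
  also have "2 * (3 + 2 * ln (1 + 2 * real M)) * real ?Q ^ (d - 1)
      = (real ?Q ^ (d - 1) * real ?Q) * ((3 + 2 * ln (1 + 2 * real M)) / M)"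
    using M by simp
  also have "real ?Q ^ (d - 1) * real ?Q = real ?Q ^ d"
    using i by (intro power_minus_mult) simp
  finally show ?thesis .
qed

lemma torus_fejer_expansion:
  "complex_of_real (torus_fejer d M z) = (\<Sum>k\<in>freq_box d M. (\<Prod>j<d. fejer_coeff M (k j)) * circle_char (torus_phase d k z))"
proof -
  have "complex_of_real (torus_fejer d M z)
      = (\<Prod>j<d. \<Sum>k\<in>{-int M<..<int M}. fejer_coeff M k * circle_char (circle_int_mult k (z j)))"
    by (simp add: torus_fejer_def fejer_expansion)
  also have "\<dots> = (\<Sum>k\<in>freq_box d M. \<Prod>j<d. fejer_coeff M (k j) * circle_char (circle_int_mult (k j) (z j)))"
    unfolding freq_box_def by (rule prod_sum_PiE) auto
  finally show ?thesis by (simp add: prod.distrib circle_char_sum torus_phase_def)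
qed

lemma torus_phase_diff: "torus_phase d k (\<lambda>j. x j - y j) = torus_phase d k x - torus_phase d k y"
  by (simp add: torus_phase_def circle_int_mult_diff_right sum_subtractf)

text \<open>Coordinates of two frequencies in the box differ by less than 2M, which is the range of
  the orthogonality relation for Q = 2M.\<close>

lemma sum_torus_grid_circle_char:
  assumes k: "k \<in> freq_box d M" "l \<in> freq_box d M"
  shows "(\<Sum>y\<in>torus_grid d (2*M). circle_char (torus_phase d k (\<lambda>j. grid_point (2*M) (y j)))
      * cnj (circle_char (torus_phase d l (\<lambda>j. grid_point (2*M) (y j))))) = (if k = l then of_nat ((2*M) ^ d) else 0)"
proof -
  let ?Q = "2 * M"
  have "(\<Sum>y\<in>torus_grid d ?Q. circle_char (torus_phase d k (\<lambda>j. grid_point ?Q (y j)))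
      * cnj (circle_char (torus_phase d l (\<lambda>j. grid_point ?Q (y j)))))
      = (\<Sum>y\<in>torus_grid d ?Q. \<Prod>j<d. circle_char (circle_int_mult (k j - l j) (grid_point ?Q (y j))))"
    by (simp add: torus_phase_def circle_int_mult_diff_left circle_char_diff circle_char_sum prod.distrib)
  also have "\<dots> = (\<Prod>j<d. \<Sum>y<?Q. circle_char (circle_int_mult (k j - l j) (grid_point ?Q y)))"
    unfolding torus_grid_def by (rule prod_sum_PiE[symmetric]) auto
  also have "\<dots> = (\<Prod>j<d. if k j - l j = 0 then of_nat ?Q else 0)"
  proof (intro prod.cong refl)
    fix j assume "j \<in> {..<d}"
    with k have "k j \<in> {-int M<..<int M}" "l j \<in> {-int M<..<int M}"
      unfolding freq_box_def by (blast intro: PiE_mem)+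
    then have "\<bar>k j - l j\<bar> < int ?Q" by auto
    then show "(\<Sum>y<?Q. circle_char (circle_int_mult (k j - l j) (grid_point ?Q y))) = (if k j - l j = 0 then of_nat ?Q else 0)"
      by (rule sum_grid_circle_char)
  qed
  also have "\<dots> = (if k = l then of_nat (?Q ^ d) else 0)"
  proof (cases "k = l")
    case False
    then obtain j where "j < d" "k j \<noteq> l j"
      using k unfolding freq_box_def by (metis PiE_ext lessThan_iff)
    then show ?thesis using False by (simp, intro bexI[of _ j]) auto
  qed simp
  finally show ?thesis .
qed

text \<open>Stated for subsets of the box so that the zero frequency can be removed before it is
  applied.\<close>

lemma parseval_torus_grid:
  fixes a :: "(nat \<Rightarrow> int) \<Rightarrow> complex"
  assumes K: "K \<subseteq> freq_box d M"
  shows "(\<Sum>y\<in>torus_grid d (2*M). (norm (\<Sum>k\<in>K. a k * cnj (circle_char (torus_phase d k (\<lambda>j. grid_point (2*M) (y j))))))\<^sup>2)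
     = real ((2*M) ^ d) * (\<Sum>k\<in>K. (norm (a k))\<^sup>2)"
proof -
  let ?e = "\<lambda>k y. circle_char (torus_phase d k (\<lambda>j. grid_point (2*M) (y j)))"
  have fin: "finite K" using K by (rule finite_subset) simp
  have "complex_of_real (\<Sum>y\<in>torus_grid d (2*M). (norm (\<Sum>k\<in>K. a k * cnj (?e k y)))\<^sup>2)
      = (\<Sum>y\<in>torus_grid d (2*M). (\<Sum>l\<in>K. a l * cnj (?e l y)) * cnj (\<Sum>k\<in>K. a k * cnj (?e k y)))"
    by (simp only: of_real_sum complex_norm_square)
  also have "\<dots> = (\<Sum>y\<in>torus_grid d (2*M). \<Sum>l\<in>K. \<Sum>k\<in>K. (a l * cnj (a k)) * (?e k y * cnj (?e l y)))"
    by (simp add: sum_product mult_ac)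
  also have "\<dots> = (\<Sum>l\<in>K. \<Sum>k\<in>K. \<Sum>y\<in>torus_grid d (2*M). (a l * cnj (a k)) * (?e k y * cnj (?e l y)))"
    by (subst sum.swap) (intro sum.cong refl sum.swap)
  also have "\<dots> = (\<Sum>l\<in>K. \<Sum>k\<in>K. if k = l then (a l * cnj (a k)) * of_nat ((2*M) ^ d) else 0)"
  proof (intro sum.cong refl)
    fix l k assume "l \<in> K" "k \<in> K"
    then show "(\<Sum>y\<in>torus_grid d (2*M). (a l * cnj (a k)) * (?e k y * cnj (?e l y)))
        = (if k = l then (a l * cnj (a k)) * of_nat ((2*M) ^ d) else 0)"
      unfolding sum_distrib_left[symmetric] using K by (subst sum_torus_grid_circle_char) auto
  qed
  also have "\<dots> = (\<Sum>l\<in>K. (a l * cnj (a l)) * of_nat ((2*M) ^ d))"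
    using fin by simp
  also have "\<dots> = complex_of_real (real ((2*M) ^ d) * (\<Sum>k\<in>K. (norm (a k))\<^sup>2))"
    by (simp only: of_real_mult of_real_sum complex_norm_square sum_distrib_left of_real_of_nat_eq mult.commute)
  finally show ?thesis by (simp only: of_real_eq_iff)
qed

section \<open>Smoothing error and discrepancy of the Fejer mean\<close>

lemma torus_dist_le:
  assumes "j < d"
  shows "circle_norm (x j - y j) \<le> torus_dist d x y"
  unfolding torus_dist_def using assms by (intro Max_ge) auto

lemma torus_dist_obtain:
  assumes "d > 0"
  obtains j where "j < d" "torus_dist d x y = circle_norm (x j - y j)"
proof -
  have "torus_dist d x y \<in> (\<lambda>j. circle_norm (x j - y j)) ` {..<d}"
    unfolding torus_dist_def using assms by (intro Max_in) auto
  then show ?thesis using that by auto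
qed

text \<open>At scale 1 / M the power is at most 1 for M t \<le> 1 and at most M t beyond. The bound
  is linear in t with constants free of \<alpha>, so the first moment of the kernel handles every
  Hoelder exponent.\<close>

lemma powr_le_rescaled:
  fixes t \<alpha> M :: real
  assumes "0 \<le> t" "0 < \<alpha>" "\<alpha> \<le> 1" "M > 0"
  shows "t powr \<alpha> \<le> M powr (- \<alpha>) * (1 + M * t)"
proof -
  have "(M * t) powr \<alpha> \<le> 1 + M * t"
  proof (cases "M * t \<le> 1")
    case True
    then have "(M * t) powr \<alpha> \<le> 1" using assms by (intro powr_le1) auto
    then show ?thesis using assms by (simp add: add_increasing2)
  next
    case False
    then have "(M * t) powr \<alpha> \<le> (M * t) powr 1" using assms by (intro powr_mono) auto
    then show ?thesis using assms False by simp
  qed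
  moreover have "t powr \<alpha> = M powr (- \<alpha>) * (M * t) powr \<alpha>"
    using assms by (simp add: powr_mult powr_minus)
  ultimately show ?thesis by (simp add: mult_left_mono)
qed

text \<open>The kernel has exact mass one after normalisation, so the error is a weighted mean of
  \<phi>(x) - \<phi>(y). The maximum distance is bounded by the sum over coordinates, and each
  coordinate contributes one first moment; hence the factor d.\<close>

lemma fejer_approximation:
  fixes \<phi> :: "(nat \<Rightarrow> circle) \<Rightarrow> real"
  assumes M: "0 < M" and d: "0 < d" and \<alpha>: "0 < \<alpha>" "\<alpha> \<le> 1" and H: "H \<ge> 0"
    and hold: "\<And>x y. x \<in> torus d \<Longrightarrow> y \<in> torus d \<Longrightarrow> \<bar>\<phi> x - \<phi> y\<bar> \<le> H * torus_dist d x y powr \<alpha>"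
    and x: "x \<in> torus d"
  shows "\<bar>\<phi> x - (\<Sum>y\<in>torus_grid d (2*M). \<phi> (torus_grid_point d (2*M) y) * torus_fejer d M (\<lambda>j. x j - grid_point (2*M) (y j))) / real (2*M) ^ d\<bar>
      \<le> H * real M powr (-\<alpha>) * (1 + d * (3 + 2 * ln (1 + 2 * real M)))"
proof -
  let ?Q = "2 * M"
  let ?K = "\<lambda>y. torus_fejer d M (\<lambda>j. x j - grid_point ?Q (y j))"
  let ?g = "torus_grid_point d ?Q"
  let ?n = "\<lambda>y j. circle_norm (x j - grid_point ?Q (y j))"
  define P where "P = real ?Q ^ d"
  have P: "P > 0" using M by (simp add: P_def)
  have one: "(\<Sum>y\<in>torus_grid d ?Q. ?K y) = P"
    unfolding P_def using M by (intro sum_torus_grid_fejer) auto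
  have pt: "\<bar>\<phi> x - \<phi> (?g y)\<bar> \<le> H * real M powr (-\<alpha>) * (1 + M * (\<Sum>j<d. ?n y j))" for y
  proof -
    obtain i where i: "i < d" "torus_dist d x (?g y) = circle_norm (x i - ?g y i)"
      using torus_dist_obtain[OF d] by blast
    then have eq: "torus_dist d x (?g y) = ?n y i" by (simp add: torus_grid_point_def)
    have "\<bar>\<phi> x - \<phi> (?g y)\<bar> \<le> H * (?n y i) powr \<alpha>"
      using hold[OF x torus_grid_point_in_torus] eq by metis
    also have "\<dots> \<le> H * (real M powr (-\<alpha>) * (1 + M * ?n y i))"
      using H M \<alpha> by (intro mult_left_mono powr_le_rescaled) auto
    also have "\<dots> \<le> H * (real M powr (-\<alpha>) * (1 + M * (\<Sum>j<d. ?n y j)))"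
      using H i by (intro mult_left_mono add_mono member_le_sum[where f = "?n y"]) auto
    finally show ?thesis by (simp add: mult.assoc)
  qed
  have "\<bar>\<phi> x * P - (\<Sum>y\<in>torus_grid d ?Q. \<phi> (?g y) * ?K y)\<bar>
      = \<bar>\<Sum>y\<in>torus_grid d ?Q. (\<phi> x - \<phi> (?g y)) * ?K y\<bar>"
    by (simp add: one[symmetric] sum_distrib_left sum_subtractf left_diff_distrib)
  also have "\<dots> \<le> (\<Sum>y\<in>torus_grid d ?Q. \<bar>(\<phi> x - \<phi> (?g y)) * ?K y\<bar>)"
    by (rule sum_abs)
  also have "\<dots> \<le> (\<Sum>y\<in>torus_grid d ?Q. (H * real M powr (-\<alpha>) * (1 + M * (\<Sum>j<d. ?n y j))) * ?K y)"
    unfolding abs_mult abs_of_nonneg[OF torus_fejer_nonneg]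
    by (intro sum_mono mult_right_mono pt torus_fejer_nonneg)
  also have "\<dots> = (\<Sum>y\<in>torus_grid d ?Q. H * real M powr (-\<alpha>) * (?K y + M * (\<Sum>j<d. ?K y * ?n y j)))"
    by (intro sum.cong refl) (simp add: sum_distrib_left algebra_simps)
  also have "\<dots> = H * real M powr (-\<alpha>) * (P + M * (\<Sum>j<d. \<Sum>y\<in>torus_grid d ?Q. ?K y * ?n y j))"
  proof -
    have fact_out: "(\<Sum>y\<in>torus_grid d ?Q. c * (?K y + M * T y)) = c * (P + M * (\<Sum>y\<in>torus_grid d ?Q. T y))"
      for c and T :: "(nat \<Rightarrow> nat) \<Rightarrow> real"
      by (simp add: one sum.distrib flip: sum_distrib_left)
    show ?thesis unfolding fact_out by (subst sum.swap) (rule refl)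
  qed
  also have "\<dots> \<le> H * real M powr (-\<alpha>) * (P + M * (\<Sum>j<d. P * ((3 + 2 * ln (1 + 2 * real M)) / M)))"
    unfolding P_def using H M
    by (intro mult_left_mono add_mono sum_mono sum_torus_grid_fejer_circle_norm) auto
  also have "\<dots> = H * real M powr (-\<alpha>) * (1 + d * (3 + 2 * ln (1 + 2 * real M))) * P"
    using M by (simp add: algebra_simps add_divide_distrib)
  finally have *: "\<bar>\<phi> x * P - (\<Sum>y\<in>torus_grid d ?Q. \<phi> (?g y) * ?K y)\<bar>
      \<le> H * real M powr (-\<alpha>) * (1 + d * (3 + 2 * ln (1 + 2 * real M))) * P" .
  have "\<phi> x - (\<Sum>y\<in>torus_grid d ?Q. \<phi> (?g y) * ?K y) / P = (\<phi> x * P - (\<Sum>y\<in>torus_grid d ?Q. \<phi> (?g y) * ?K y)) / P"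
    using P by (simp add: field_simps)
  then have "\<bar>\<phi> x - (\<Sum>y\<in>torus_grid d ?Q. \<phi> (?g y) * ?K y) / P\<bar>
      = \<bar>\<phi> x * P - (\<Sum>y\<in>torus_grid d ?Q. \<phi> (?g y) * ?K y)\<bar> / P"
    using P by simp
  also have "\<dots> \<le> H * real M powr (-\<alpha>) * (1 + d * (3 + 2 * ln (1 + 2 * real M)))"
    using * P by (simp add: pos_divide_le_eq)
  finally show ?thesis by (simp only: P_def)
qed

text \<open>After exchanging the sums, \<phi> is integrated against \<open>D\<close>, the orbit
  average of the kernel minus 1. Subtracting 1 cancels the zero frequency, so the coefficients of
  \<open>D\<close> are at most \<open>a\<close>. Parseval with at most (2M)^d frequencies bounds
  \<open>D\<close> in L^2, and Cauchy-Schwarz on the grid passes to L^1; \<phi> enters through its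
  supremum alone.\<close>

lemma fejer_mean_discrepancy:
  fixes \<phi> :: "(nat \<Rightarrow> circle) \<Rightarrow> real" and x :: "nat \<Rightarrow> nat \<Rightarrow> circle"
  assumes M: "0 < M" and N: "0 < N" and S: "\<And>y. y \<in> torus d \<Longrightarrow> \<bar>\<phi> y\<bar> \<le> S" "S \<ge> 0" and a: "a \<ge> 0"
    and exp_sum: "\<And>k. k \<in> freq_box d M \<Longrightarrow> \<exists>j<d. k j \<noteq> 0 \<Longrightarrow> norm (\<Sum>n<N. circle_char (torus_phase d k (x n))) / N \<le> a"
  shows "\<bar>(\<Sum>n<N. (\<Sum>y\<in>torus_grid d (2*M). \<phi> (torus_grid_point d (2*M) y) * torus_fejer d M (\<lambda>j. x n j - grid_point (2*M) (y j))) / real (2*M) ^ d) / N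
       - (\<Sum>y\<in>torus_grid d (2*M). \<phi> (torus_grid_point d (2*M) y)) / real (2*M) ^ d\<bar>
      \<le> S * (a * sqrt (real (2*M) ^ d))"
proof -
  let ?Q = "2 * M"
  let ?G = "torus_grid d ?Q"
  let ?g = "torus_grid_point d ?Q"
  let ?e = "\<lambda>k y. circle_char (torus_phase d k (\<lambda>j. grid_point (2*M) (y j)))"
  define P where "P = real ?Q ^ d"
  have P: "P > 0" using M by (simp add: P_def)
  \<comment> \<open>The zero frequency must be the extensional zero function to lie in
    \<open>freq_box\<close>; any other member of the box then has a nonzero coordinate below
    d.\<close>
  define k0 :: "nat \<Rightarrow> int" where "k0 = (\<lambda>j\<in>{..<d}. 0)"
  have k0: "k0 \<in> freq_box d M" using M by (auto simp: k0_def freq_box_def)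
  define K where "K = freq_box d M - {k0}"
  define A where "A k = (\<Sum>n<N. circle_char (torus_phase d k (x n))) / N" for k
  define c where "c k = (\<Prod>j<d. fejer_coeff M (k j))" for k :: "nat \<Rightarrow> int"
  have c: "0 \<le> c k" "c k \<le> 1" for k
    unfolding c_def by (auto intro!: prod_nonneg prod_le_1 fejer_coeff_le_1)
  define D where "D y = (\<Sum>n<N. torus_fejer d M (\<lambda>j. x n j - grid_point ?Q (y j))) / N - 1" for y
  have D: "complex_of_real (D y) = (\<Sum>k\<in>K. (c k * A k) * cnj (?e k y))" for y
  proof -
    have "complex_of_real ((\<Sum>n<N. torus_fejer d M (\<lambda>j. x n j - grid_point ?Q (y j))) / N)
        = (\<Sum>n<N. \<Sum>k\<in>freq_box d M. c k * (circle_char (torus_phase d k (x n)) * cnj (?e k y))) / N"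
      by (simp add: torus_fejer_expansion c_def torus_phase_diff circle_char_diff)
    also have "\<dots> = (\<Sum>k\<in>freq_box d M. \<Sum>n<N. c k * (circle_char (torus_phase d k (x n)) * cnj (?e k y))) / N"
      by (subst sum.swap) simp
    also have "\<dots> = (\<Sum>k\<in>freq_box d M. (c k * A k) * cnj (?e k y))"
      by (simp add: A_def sum_divide_distrib sum_distrib_left sum_distrib_right mult_ac)
    also have "\<dots> = (c k0 * A k0) * cnj (?e k0 y) + (\<Sum>k\<in>K. (c k * A k) * cnj (?e k y))"
      unfolding K_def using k0 by (subst sum.remove[of _ k0]) auto
    also have "(c k0 * A k0) * cnj (?e k0 y) = 1"
      using N M by (simp add: c_def A_def k0_def torus_phase_def fejer_coeff_0)
    finally show ?thesis by (simp add: D_def)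
  qed
  have bound: "norm (complex_of_real (c k) * A k) \<le> a" if k: "k \<in> K" for k
  proof -
    have "\<exists>j<d. k j \<noteq> 0"
    proof (rule ccontr)
      assume "\<not> ?thesis"
      then have "k = k0"
        using k unfolding K_def freq_box_def k0_def by (intro extensionalityI[of _ "{..<d}"]) (auto simp: PiE_iff)
      with k show False by (simp add: K_def)
    qed
    then have "norm (A k) \<le> a"
      using exp_sum[of k] k by (simp add: A_def K_def norm_divide)
    then have "c k * norm (A k) \<le> 1 * a" using c by (intro mult_mono) auto
    then show ?thesis using c by (simp add: norm_mult)
  qed
  have "(\<Sum>y\<in>?G. (D y)\<^sup>2) = (\<Sum>y\<in>?G. (norm (\<Sum>k\<in>K. (c k * A k) * cnj (?e k y)))\<^sup>2)"
    by (simp flip: D)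
  also have "\<dots> = P * (\<Sum>k\<in>K. (norm (complex_of_real (c k) * A k))\<^sup>2)"
    by (subst parseval_torus_grid) (auto simp: P_def K_def)
  also have "\<dots> \<le> P * (\<Sum>k\<in>K. a\<^sup>2)"
    using bound P by (intro mult_left_mono sum_mono power_mono) auto
  also have "\<dots> = P * (card K * a\<^sup>2)" by simp
  also have "\<dots> \<le> P * (P * a\<^sup>2)"
  proof -
    have "card K \<le> card (freq_box d M)" unfolding K_def by (intro card_mono) auto
    also have "\<dots> \<le> ?Q ^ d" by (rule card_freq_box_le)
    finally have "real (card K) \<le> P" unfolding P_def by (metis of_nat_le_iff of_nat_power)
    then show ?thesis using P by (intro mult_left_mono mult_right_mono) auto
  qed
  finally have D2: "(\<Sum>y\<in>?G. (D y)\<^sup>2) \<le> P * (P * a\<^sup>2)" .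
  \<comment> \<open>Both the grid and the set of frequencies have size at most P, so the square is
    at most P^3 a^2, that is (P a sqrt P)^2.\<close>
  have "(\<Sum>y\<in>?G. \<bar>D y\<bar>)\<^sup>2 \<le> (\<Sum>y\<in>?G. \<bar>D y\<bar>\<^sup>2) * card ?G"
    by (rule sum_squared_le_sum_of_squares)
  also have "\<dots> \<le> P * (P * a\<^sup>2) * P"
    using D2 P by (intro mult_mono) (auto simp: card_torus_grid P_def)
  also have "\<dots> = (P * (a * sqrt P))\<^sup>2"
    using P by (simp add: power_mult_distrib power2_eq_square)
  finally have D1: "(\<Sum>y\<in>?G. \<bar>D y\<bar>) \<le> P * (a * sqrt P)"
    by (rule power2_le_imp_le) (use P a in auto)
  have "(\<Sum>n<N. (\<Sum>y\<in>?G. \<phi> (?g y) * torus_fejer d M (\<lambda>j. x n j - grid_point ?Q (y j))) / P) / N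
      = (\<Sum>y\<in>?G. \<phi> (?g y) * ((\<Sum>n<N. torus_fejer d M (\<lambda>j. x n j - grid_point ?Q (y j))) / N)) / P"
    unfolding sum_divide_distrib sum_distrib_left by (subst sum.swap) (simp add: mult_ac)
  then have "(\<Sum>n<N. (\<Sum>y\<in>?G. \<phi> (?g y) * torus_fejer d M (\<lambda>j. x n j - grid_point ?Q (y j))) / P) / N
      - (\<Sum>y\<in>?G. \<phi> (?g y)) / P = (\<Sum>y\<in>?G. \<phi> (?g y) * D y) / P"
    by (simp add: D_def right_diff_distrib sum_subtractf diff_divide_distrib)
  also have "\<bar>\<dots>\<bar> \<le> (\<Sum>y\<in>?G. S * \<bar>D y\<bar>) / P"
    using P S(1)[OF torus_grid_point_in_torus]
    by (auto simp: abs_mult intro!: divide_right_mono order_trans[OF sum_abs] sum_mono mult_right_mono)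
  also have "\<dots> \<le> S * (P * (a * sqrt P)) / P"
    unfolding sum_distrib_left[symmetric] using D1 S P by (intro divide_right_mono mult_left_mono) auto
  also have "\<dots> = S * (a * sqrt P)" using P by simp
  finally show ?thesis by (simp only: P_def)
qed

section \<open>Grid averages and the Haar integral\<close>

text \<open>Half-open, so that the arcs with i < Q partition the circle without overlaps.\<close>

definition grid_arc :: "nat \<Rightarrow> nat \<Rightarrow> circle set" where
  "grid_arc Q i = to_circle ` {real i / real Q..<(real i + 1) / real Q}"

lemma inj_on_to_circle: "inj_on to_circle {0..<1}"
proof (rule inj_onI)
  fix x y assume *: "x \<in> {0..<1}" "y \<in> {0..<1}" "to_circle x = to_circle y"
  then obtain n where "x - y = of_int n" by (auto simp: circle.abs_eq_iff elim: Ints_cases)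
  moreover have "\<bar>x - y\<bar> < 1" using * by auto
  ultimately have "\<bar>real_of_int n\<bar> < 1" by simp
  then have "n = 0" by linarith
  then show "x = y" using \<open>x - y = of_int n\<close> by simp
qed

lemma grid_cell_subset: "i < Q \<Longrightarrow> {real i / real Q..<(real i + 1) / Q} \<subseteq> {0..<1}"
proof
  fix x assume i: "i < Q" and x: "x \<in> {real i / real Q..<(real i + 1) / Q}"
  have "0 \<le> real i / real Q" "(real i + 1) / real Q \<le> 1" using i by (auto simp: field_simps)
  with x show "x \<in> {0..<1}" unfolding atLeastLessThan_iff by linarith
qed

text \<open>Images of Borel sets need care; a half-open interval is a countable union of compact
  ones, whose continuous images are compact and hence closed.\<close>

lemma measurable_to_circle_image_Ico: "to_circle ` {a..<b} \<in> sets borel"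
proof -
  have "{a..<b} = (\<Union>n. {a..b - 1 / real (Suc n)})"
  proof (intro equalityI subsetI)
    fix x assume x: "x \<in> {a..<b}"
    then obtain n where "1 / real (Suc n) < b - x" using nat_approx_posE[of "b - x"] by auto
    then show "x \<in> (\<Union>n. {a..b - 1 / real (Suc n)})" using x by (intro UN_I[of n]) auto
  next
    fix x assume "x \<in> (\<Union>n. {a..b - 1 / real (Suc n)})"
    then obtain n where "a \<le> x" "x \<le> b - 1 / real (Suc n)" by auto
    moreover have "1 / real (Suc n) > 0" by simp
    ultimately show "x \<in> {a..<b}" unfolding atLeastLessThan_iff by linarith
  qed
  then have "to_circle ` {a..<b} = (\<Union>n. to_circle ` {a..b - 1 / real (Suc n)})" by blast
  moreover have "closed (to_circle ` {a..b - 1 / real (Suc n)})" for n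
    by (intro compact_imp_closed compact_continuous_image continuous_on_to_circle) auto
  ultimately show ?thesis by (auto intro: sets.countable_UN borel_closed)
qed

lemma sets_grid_arc [measurable]: "grid_arc Q i \<in> sets borel"
  unfolding grid_arc_def by (rule measurable_to_circle_image_Ico)

lemma emeasure_grid_arc:
  assumes "i < Q"
  shows "emeasure circle_haar (grid_arc Q i) = ennreal (1 / Q)"
proof -
  have "to_circle -` grid_arc Q i \<inter> {0..<1} = {real i / real Q..<(real i + 1) / real Q}"
    unfolding grid_arc_def
    using inj_on_image_mem_iff[OF inj_on_to_circle _ grid_cell_subset[OF assms]] grid_cell_subset[OF assms]
    by blast
  then have "emeasure circle_haar (grid_arc Q i) = emeasure lborel {real i / real Q..<(real i + 1) / real Q}"
    by (simp add: emeasure_circle_haar)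
  also have "\<dots> = ennreal ((real i + 1) / real Q - real i / real Q)"
    by (intro emeasure_lborel_Ico divide_right_mono) auto
  finally show ?thesis by (simp add: add_divide_distrib)
qed

lemma ex1_grid_arc:
  assumes Q: "Q > 0"
  shows "\<exists>!i. i < Q \<and> t \<in> grid_arc Q i"
proof -
  obtain x where x: "t = to_circle x" "0 \<le> x" "x < 1"
    by (metis Quotient3_circle Quotient3_abs_rep frac_ge_0 frac_lt_1 to_circle_frac)
  have cell: "y \<in> {real i / real Q..<(real i + 1) / real Q} \<longleftrightarrow> real i \<le> y * real Q \<and> y * real Q < real i + 1" for i and y :: real
    using Q by (auto simp: field_simps)
  define i where "i = nat \<lfloor>x * Q\<rfloor>"
  have i: "real i \<le> x * real Q" "x * real Q < real i + 1"
    unfolding i_def using x by (auto intro!: of_nat_floor)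
  have "x * Q < Q" using x Q by simp
  then have iQ: "i < Q" using i by linarith
  show ?thesis
  proof (intro ex1I[of _ i] conjI)
    show "t \<in> grid_arc Q i" unfolding grid_arc_def using x i cell by blast
    fix i' assume i': "i' < Q \<and> t \<in> grid_arc Q i'"
    then obtain y where y: "t = to_circle y" "y \<in> {real i' / real Q..<(real i' + 1) / real Q}"
      unfolding grid_arc_def by auto
    then have "y \<in> {0..<1}" using grid_cell_subset[of i' Q] i' by blast
    then have "y = x" using inj_on_to_circle x y by (auto dest: inj_onD)
    then have "real i' \<le> x * real Q" "x * real Q < real i' + 1" using y cell by auto
    then show "i' = i" using i by linarith
  qed (fact iQ)
qed

lemma circle_norm_grid_arc:
  assumes "t \<in> grid_arc Q i"
  shows "circle_norm (t - grid_point Q i) \<le> 1 / Q"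
proof -
  obtain y where y: "t = to_circle y" "real i / real Q \<le> y" "y < (real i + 1) / real Q"
    using assms by (auto simp: grid_arc_def)
  have "circle_norm (t - grid_point Q i) \<le> \<bar>y - i / Q\<bar>"
    using dist_to_circle_le[of y "i / Q"] by (simp add: y(1) grid_point_def dist_circle_def dist_real_def)
  also have "\<dots> \<le> 1 / Q" using y by (simp add: add_divide_distrib)
  finally show ?thesis .
qed

section \<open>Grid boxes as a partition of the torus into sets of equal Haar measure\<close>

definition grid_box :: "nat \<Rightarrow> nat \<Rightarrow> (nat \<Rightarrow> nat) \<Rightarrow> (nat \<Rightarrow> circle) set" where
  "grid_box d Q y = PiE {..<d} (\<lambda>j. grid_arc Q (y j))"

interpretation circle_haar: finite_measure circle_haar
  by (rule finite_measureI) (simp add: emeasure_circle_haar_UNIV)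

interpretation circle_haar_product: product_sigma_finite "\<lambda>_ :: nat. circle_haar" ..

interpretation torus_haar: finite_measure "torus_haar d"
proof (rule finite_measureI)
  have "emeasure (torus_haar d) (PiE {..<d} (\<lambda>_. UNIV)) = (\<Prod>j<d. emeasure circle_haar UNIV)"
    unfolding torus_haar_def by (rule circle_haar_product.emeasure_PiM) auto
  then show "emeasure (torus_haar d) (space (torus_haar d)) \<noteq> \<infinity>"
    by (simp add: space_torus_haar torus_def emeasure_circle_haar_UNIV)
qed

lemma measure_torus_haar_space: "measure (torus_haar d) (torus d) = 1"
proof -
  have "emeasure (torus_haar d) (PiE {..<d} (\<lambda>_. UNIV)) = (\<Prod>j<d. emeasure circle_haar UNIV)"
    unfolding torus_haar_def by (rule circle_haar_product.emeasure_PiM) auto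
  then show ?thesis by (simp add: measure_def torus_def emeasure_circle_haar_UNIV)
qed

lemma sets_grid_box [measurable]: "grid_box d Q y \<in> sets (torus_haar d)"
  unfolding grid_box_def torus_haar_def by (intro sets_PiM_I_finite) auto

lemma measure_grid_box:
  assumes "y \<in> torus_grid d Q"
  shows "measure (torus_haar d) (grid_box d Q y) = 1 / real Q ^ d"
proof -
  have "emeasure (torus_haar d) (grid_box d Q y) = (\<Prod>j<d. emeasure circle_haar (grid_arc Q (y j)))"
    unfolding torus_haar_def grid_box_def by (rule circle_haar_product.emeasure_PiM) auto
  also have "\<dots> = (\<Prod>j<d. ennreal (1 / Q))"
    using assms by (intro prod.cong refl emeasure_grid_arc) (auto simp: torus_grid_def PiE_iff)
  also have "\<dots> = ennreal ((1 / Q) ^ d)" by (simp add: ennreal_power)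
  finally show ?thesis by (simp add: measure_def power_divide)
qed

lemma ex1_grid_box:
  assumes Q: "Q > 0" and x: "x \<in> torus d"
  shows "\<exists>!y. y \<in> torus_grid d Q \<and> x \<in> grid_box d Q y"
proof -
  define y where "y = (\<lambda>j\<in>{..<d}. THE i. i < Q \<and> x j \<in> grid_arc Q i)"
  have y: "y j < Q \<and> x j \<in> grid_arc Q (y j)" if "j < d" for j
    using theI'[OF ex1_grid_arc[OF Q, of "x j"]] that by (simp add: y_def)
  show ?thesis
  proof (intro ex1I[of _ y] conjI)
    show "y \<in> torus_grid d Q" using y by (auto simp: torus_grid_def y_def)
    show "x \<in> grid_box d Q y" using y x by (auto simp: grid_box_def torus_def PiE_iff)
    fix z assume z: "z \<in> torus_grid d Q \<and> x \<in> grid_box d Q z"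
    show "z = y"
    proof (rule extensionalityI[of _ "{..<d}"])
      show "z \<in> extensional {..<d}" using z by (auto simp: torus_grid_def PiE_iff)
      show "y \<in> extensional {..<d}" by (simp add: y_def)
      fix j assume j: "j \<in> {..<d}"
      then have "z j < Q \<and> x j \<in> grid_arc Q (z j)"
        using z by (auto simp: torus_grid_def grid_box_def PiE_iff)
      then show "z j = y j" using ex1_grid_arc[OF Q, of "x j"] y[of j] j by auto
    qed
  qed
qed

lemma grid_step_approximation:
  fixes \<phi> :: "(nat \<Rightarrow> circle) \<Rightarrow> real"
  assumes Q: "Q > 0" and d: "0 < d" and \<alpha>: "0 < \<alpha>" and H: "H \<ge> 0"
    and hold: "\<And>x y. x \<in> torus d \<Longrightarrow> y \<in> torus d \<Longrightarrow> \<bar>\<phi> x - \<phi> y\<bar> \<le> H * torus_dist d x y powr \<alpha>"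
    and x: "x \<in> torus d"
  shows "\<bar>\<phi> x - (\<Sum>y\<in>torus_grid d Q. \<phi> (torus_grid_point d Q y) * indicator (grid_box d Q y) x)\<bar> \<le> H * (1 / Q) powr \<alpha>"
proof -
  define y where "y = (THE y. y \<in> torus_grid d Q \<and> x \<in> grid_box d Q y)"
  have y: "y \<in> torus_grid d Q" "x \<in> grid_box d Q y"
    using theI'[OF ex1_grid_box[OF Q x]] by (simp_all add: y_def)
  have uniq: "z = y" if "z \<in> torus_grid d Q" "x \<in> grid_box d Q z" for z
    unfolding y_def using the1_equality[OF ex1_grid_box[OF Q x], of z] that by simp
  have "(\<Sum>z\<in>torus_grid d Q. \<phi> (torus_grid_point d Q z) * indicator (grid_box d Q z) x)
      = (\<Sum>z\<in>torus_grid d Q. if z = y then \<phi> (torus_grid_point d Q y) else 0)"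
  proof (intro sum.cong refl)
    fix z assume z: "z \<in> torus_grid d Q"
    show "\<phi> (torus_grid_point d Q z) * indicator (grid_box d Q z) x = (if z = y then \<phi> (torus_grid_point d Q y) else 0)"
    proof (cases "z = y")
      case False
      with z uniq have "x \<notin> grid_box d Q z" by blast
      with False show ?thesis by simp
    qed (simp add: y)
  qed
  also have "\<dots> = \<phi> (torus_grid_point d Q y)" using y by simp
  finally have eq: "(\<Sum>z\<in>torus_grid d Q. \<phi> (torus_grid_point d Q z) * indicator (grid_box d Q z) x)
      = \<phi> (torus_grid_point d Q y)" .
  obtain i where i: "i < d" "torus_dist d x (torus_grid_point d Q y) = circle_norm (x i - torus_grid_point d Q y i)"
    by (rule torus_dist_obtain[OF d])
  have "circle_norm (x i - torus_grid_point d Q y i) \<le> 1 / Q"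
  proof -
    have "x i \<in> grid_arc Q (y i)" using PiE_mem[OF y(2)[unfolded grid_box_def], of i] i(1) by simp
    then have "circle_norm (x i - grid_point Q (y i)) \<le> 1 / Q" by (rule circle_norm_grid_arc)
    then show ?thesis using i(1) by (simp add: torus_grid_point_def)
  qed
  then have "torus_dist d x (torus_grid_point d Q y) powr \<alpha> \<le> (1 / Q) powr \<alpha>"
    using i \<alpha> by (intro powr_mono2) auto
  then have "H * torus_dist d x (torus_grid_point d Q y) powr \<alpha> \<le> H * (1 / Q) powr \<alpha>"
    using H by (rule mult_left_mono)
  with hold[OF x torus_grid_point_in_torus, of Q y] show ?thesis unfolding eq by linarith
qed

text \<open>The grid average is the integral of the step function taking on each box the value at
  its grid point, and this is uniformly close to \<phi>. The step functions for finer and finer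
  grids also converge to \<phi> pointwise, which yields its measurability for the product
  sigma-algebra.\<close>

lemma integral_torus_haar_grid:
  fixes \<phi> :: "(nat \<Rightarrow> circle) \<Rightarrow> real"
  assumes Q: "Q > 0" and d: "0 < d" and \<alpha>: "0 < \<alpha>" and H: "H \<ge> 0"
    and hold: "\<And>x y. x \<in> torus d \<Longrightarrow> y \<in> torus d \<Longrightarrow> \<bar>\<phi> x - \<phi> y\<bar> \<le> H * torus_dist d x y powr \<alpha>"
    and S: "\<And>x. x \<in> torus d \<Longrightarrow> \<bar>\<phi> x\<bar> \<le> S"
  shows "\<bar>(\<Sum>y\<in>torus_grid d Q. \<phi> (torus_grid_point d Q y)) / real Q ^ d - (\<integral>y. \<phi> y \<partial>torus_haar d)\<bar> \<le> H * (1 / Q) powr \<alpha>"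
proof -
  define st where "st Q x = (\<Sum>y\<in>torus_grid d Q. \<phi> (torus_grid_point d Q y) * indicator (grid_box d Q y) x)" for Q x
  have st: "\<bar>\<phi> x - st Q x\<bar> \<le> H * (1 / Q) powr \<alpha>" if "x \<in> torus d" "Q > 0" for Q x
    unfolding st_def by (rule grid_step_approximation[OF that(2) d \<alpha> H hold that(1)])
  have st_meas [measurable]: "st Q \<in> borel_measurable (torus_haar d)" for Q
    unfolding st_def by measurable
  have meas [measurable]: "\<phi> \<in> borel_measurable (torus_haar d)"
  proof (rule borel_measurable_LIMSEQ_real)
    fix x assume "x \<in> space (torus_haar d)"
    then have x: "x \<in> torus d" by (simp add: space_torus_haar)
    have "(\<lambda>n. (1 / real (Suc n)) powr \<alpha>) \<longlonglongrightarrow> 0"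
      using \<alpha> LIMSEQ_inverse_real_of_nat by (intro tendsto_zero_powrI[where b = \<alpha>]) (auto simp: inverse_eq_divide)
    then have "(\<lambda>n. H * (1 / real (Suc n)) powr \<alpha>) \<longlonglongrightarrow> 0"
      by (rule tendsto_mult_right_zero)
    then have "(\<lambda>n. st (Suc n) x - \<phi> x) \<longlonglongrightarrow> 0"
    proof (rule Lim_null_comparison[rotated], intro always_eventually allI)
      show "norm (st (Suc n) x - \<phi> x) \<le> H * (1 / real (Suc n)) powr \<alpha>" for n
        using st[OF x, of "Suc n"] by (simp add: abs_minus_commute)
    qed
    then show "(\<lambda>n. st (Suc n) x) \<longlonglongrightarrow> \<phi> x"
      by (rule LIM_zero_cancel)
  qed measurable
  \<comment> \<open>A non-integrable function would have Bochner integral 0 by convention, so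
    integrability is what gives the statement its content.\<close>
  have int: "integrable (torus_haar d) \<phi>"
    using S by (intro torus_haar.integrable_const_bound[where B = S]) (auto simp: space_torus_haar)
  have int_box: "integrable (torus_haar d) (\<lambda>x. \<phi> (torus_grid_point d Q y) * indicator (grid_box d Q y) x)" for y
    by (intro integrable_mult_right integrable_real_indicator) (auto simp: less_top[symmetric] torus_haar.emeasure_finite)
  then have int_st: "integrable (torus_haar d) (st Q)"
    unfolding st_def by (intro Bochner_Integration.integrable_sum) auto
  have "(\<integral>x. st Q x \<partial>torus_haar d) = (\<Sum>y\<in>torus_grid d Q. \<phi> (torus_grid_point d Q y) * measure (torus_haar d) (grid_box d Q y))"
    unfolding st_def using int_box
    by (subst Bochner_Integration.integral_sum) (auto intro!: sum.cong)
  also have "\<dots> = (\<Sum>y\<in>torus_grid d Q. \<phi> (torus_grid_point d Q y)) / real Q ^ d"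
    by (simp add: measure_grid_box sum_divide_distrib)
  finally have eq: "(\<integral>x. st Q x \<partial>torus_haar d) = (\<Sum>y\<in>torus_grid d Q. \<phi> (torus_grid_point d Q y)) / real Q ^ d" .
  have "\<bar>(\<integral>x. st Q x \<partial>torus_haar d) - (\<integral>y. \<phi> y \<partial>torus_haar d)\<bar> = \<bar>\<integral>x. st Q x - \<phi> x \<partial>torus_haar d\<bar>"
    using int int_st by simp
  also have "\<dots> \<le> (\<integral>x. \<bar>st Q x - \<phi> x\<bar> \<partial>torus_haar d)"
    using integral_norm_bound[of "torus_haar d" "\<lambda>x. st Q x - \<phi> x"] by simp
  also have "\<dots> \<le> (\<integral>x. H * (1 / Q) powr \<alpha> \<partial>torus_haar d)"
    using int int_st st Q by (intro integral_mono) (auto simp: space_torus_haar abs_minus_commute)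
  also have "\<dots> = H * (1 / Q) powr \<alpha>"
    using measure_torus_haar_space[of d] by (simp add: space_torus_haar)
  finally show ?thesis unfolding eq .
qed

section \<open>The rate of convergence\<close>

lemma bdd_above_holder_functions:
  assumes d: "d > 0" and \<alpha>: "\<alpha> > 0" and \<phi>: "\<phi> \<in> holder_functions d \<alpha>"
  shows "bdd_above ((\<lambda>x. \<bar>\<phi> x\<bar>) ` torus d)"
    and "bdd_above ((\<lambda>(x, y). \<bar>\<phi> x - \<phi> y\<bar> / torus_dist d x y powr \<alpha>) ` {(x, y). x \<in> torus d \<and> y \<in> torus d \<and> x \<noteq> y})"
proof -
  obtain L where L: "\<And>x y. x \<in> torus d \<Longrightarrow> y \<in> torus d \<Longrightarrow> \<bar>\<phi> x - \<phi> y\<bar> \<le> L * torus_dist d x y powr \<alpha>"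
    using \<phi> unfolding holder_functions_def by blast
  have dist: "0 \<le> torus_dist d x y" "torus_dist d x y \<le> 1" for x y
  proof -
    obtain j where "torus_dist d x y = circle_norm (x j - y j)" by (rule torus_dist_obtain[OF d])
    then show "0 \<le> torus_dist d x y" "torus_dist d x y \<le> 1"
      using circle_norm_le_half[of "x j - y j"] by simp_all
  qed
  have "\<bar>\<phi> x\<bar> \<le> \<bar>\<phi> (\<lambda>_\<in>{..<d}. 0)\<bar> + \<bar>L\<bar>" if x: "x \<in> torus d" for x
  proof -
    have "(\<lambda>_\<in>{..<d}. 0 :: circle) \<in> torus d" by (simp add: torus_def)
    then have "\<bar>\<phi> x - \<phi> (\<lambda>_\<in>{..<d}. 0)\<bar> \<le> L * torus_dist d x (\<lambda>_\<in>{..<d}. 0) powr \<alpha>"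
      using L x by blast
    also have "\<dots> \<le> \<bar>L\<bar> * 1"
      using dist[of x "\<lambda>_\<in>{..<d}. 0"] \<alpha> by (intro mult_mono powr_le1) auto
    finally show ?thesis by simp
  qed
  then show "bdd_above ((\<lambda>x. \<bar>\<phi> x\<bar>) ` torus d)" by (rule bdd_aboveI2)
  have "\<bar>\<phi> x - \<phi> y\<bar> / torus_dist d x y powr \<alpha> \<le> \<bar>L\<bar>" if "x \<in> torus d" "y \<in> torus d" for x y
  \<comment> \<open>In the case of a zero denominator the quotient is 0 by the convention for
    division.\<close>
  proof (cases "torus_dist d x y powr \<alpha> = 0")
    case False
    then have "torus_dist d x y powr \<alpha> > 0" by (metis powr_ge_zero less_eq_real_def)
    moreover have "\<bar>\<phi> x - \<phi> y\<bar> \<le> \<bar>L\<bar> * torus_dist d x y powr \<alpha>"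
      by (rule order_trans[OF L[OF that]]) (intro mult_right_mono, auto)
    ultimately show ?thesis by (simp add: pos_divide_le_eq)
  qed simp
  then show "bdd_above ((\<lambda>(x, y). \<bar>\<phi> x - \<phi> y\<bar> / torus_dist d x y powr \<alpha>) ` {(x, y). x \<in> torus d \<and> y \<in> torus d \<and> x \<noteq> y})"
    by (intro bdd_aboveI[of _ "\<bar>L\<bar>"]) auto
qed

lemma abs_le_sup_norm:
  assumes "d > 0" "\<alpha> > 0" "\<phi> \<in> holder_functions d \<alpha>" "x \<in> torus d"
  shows "\<bar>\<phi> x\<bar> \<le> sup_norm d \<phi>"
  unfolding sup_norm_def using bdd_above_holder_functions(1)[OF assms(1-3)] assms(4)
  by (intro cSUP_upper) auto

lemma torus_dist_pos:
  assumes "x \<in> torus d" "y \<in> torus d" "x \<noteq> y"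
  shows "torus_dist d x y > 0"
proof -
  obtain j where j: "j < d" "x j \<noteq> y j"
    using assms unfolding torus_def by (metis PiE_ext lessThan_iff)
  then have "circle_norm (x j - y j) > 0"
    by (simp add: less_le circle_norm_eq_0_iff eq_commute[of 0])
  with torus_dist_le[of j d x y] j show ?thesis by linarith
qed

lemma abs_diff_le_holder_seminorm:
  assumes "d > 0" "\<alpha> > 0" "\<phi> \<in> holder_functions d \<alpha>" and x: "x \<in> torus d" and y: "y \<in> torus d"
  shows "\<bar>\<phi> x - \<phi> y\<bar> \<le> holder_seminorm d \<alpha> \<phi> * torus_dist d x y powr \<alpha>"
proof (cases "x = y")
  case True
  obtain j where "torus_dist d x x = circle_norm (x j - x j)" by (rule torus_dist_obtain[OF assms(1)])
  then have "torus_dist d x x = 0" using circle_norm_eq_0_iff[of 0] by simp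
  then show ?thesis using True by simp
next
  case False
  have "\<bar>\<phi> x - \<phi> y\<bar> / torus_dist d x y powr \<alpha> \<le> holder_seminorm d \<alpha> \<phi>"
    unfolding holder_seminorm_def
    using cSUP_upper[OF _ bdd_above_holder_functions(2)[OF assms(1-3)], of "(x, y)"] False x y by simp
  moreover have "torus_dist d x y powr \<alpha> > 0" using torus_dist_pos[OF x y False] by simp
  ultimately show ?thesis by (simp add: pos_divide_le_eq)
qed

text \<open>A real supremum of nonnegative numbers is known to be nonnegative only over a nonempty
  set. The points with all coordinates 0 and all coordinates 1/2 provide a pair at positive
  distance.\<close>

lemma holder_seminorm_nonneg:
  assumes "d > 0" "\<alpha> > 0" "\<phi> \<in> holder_functions d \<alpha>"
  shows "holder_seminorm d \<alpha> \<phi> \<ge> 0"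
proof -
  define z where "z = (\<lambda>_\<in>{..<d}. 0 :: circle)"
  define w where "w = (\<lambda>_\<in>{..<d}. to_circle (1 / 2))"
  have mem: "z \<in> torus d" "w \<in> torus d" by (simp_all add: z_def w_def torus_def)
  have "to_circle (1 / 2) \<noteq> 0"
    using circle_norm_eq_0_iff[of "to_circle (1 / 2)"] by (simp add: circle_norm.abs_eq infdist_Ints_eq_abs)
  then have "z 0 \<noteq> w 0" using assms(1) by (simp add: z_def w_def)
  then have "torus_dist d z w > 0" using torus_dist_pos[OF mem] by auto
  then have "torus_dist d z w powr \<alpha> > 0" by simp
  moreover have "0 \<le> holder_seminorm d \<alpha> \<phi> * torus_dist d z w powr \<alpha>"
    by (rule order_trans[OF abs_ge_zero abs_diff_le_holder_seminorm[OF assms mem]])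
  ultimately show ?thesis by (simp add: zero_le_mult_iff)
qed

lemma orbit_in_torus: "x \<in> torus d \<Longrightarrow> (skew_product d \<omega> ^^ n) x \<in> torus d"
  by (cases n) (simp_all add: skew_product_in_torus)

text \<open>The exponent comes from balancing the smoothing error \<open>M powr (- \<alpha>)\<close> against the exponential
  sums \<open>(M / N) powr \<delta>\<close>, accumulated over \<open>M ^ d\<close> frequencies in the sense of \<open>L\<^sup>2\<close>. Because
  \<open>\<alpha> \<le> d / 2\<close>, the choice \<open>M = N powr (\<delta> / (\<delta> + d))\<close> leaves the smoothing error dominant.\<close>

lemma birkhoff_average_rate:
  fixes d :: nat and \<gamma> \<delta> :: real
  assumes d: "d \<ge> 2" and \<gamma>: "\<gamma> > 0" and \<delta>: "\<delta> = 1 / 2 ^ (d - 1)"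
  shows "\<exists>V. subpolynomial V \<and> (\<forall>\<alpha> \<phi> \<omega> N x. 0 < \<alpha> \<longrightarrow> \<alpha> \<le> 1 \<longrightarrow> \<phi> \<in> holder_functions d \<alpha> \<longrightarrow>
       diophantine \<gamma> \<omega> \<longrightarrow> N \<ge> 1 \<longrightarrow> x \<in> torus d \<longrightarrow>
       \<bar>1 / N * birkhoff_sum d \<omega> \<phi> N x - (\<integral>y. \<phi> y \<partial>torus_haar d)\<bar>
         \<le> V N * holder_norm d \<alpha> \<phi> * real N powr (- (\<alpha> * \<delta> / (\<delta> + d))))"
proof -
  obtain U where U: "subpolynomial U" "\<And>N. U N \<ge> 1"
    and all: "\<forall>\<omega> N m k x. diophantine \<gamma> \<omega> \<longrightarrow> 1 \<le> m \<longrightarrow> m \<le> N \<longrightarrow>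
      (\<forall>j<d. \<bar>k j\<bar> \<le> int m) \<longrightarrow> (\<exists>j<d. k j \<noteq> 0) \<longrightarrow>
      (norm (\<Sum>n<N. circle_char (torus_phase d k ((skew_product d \<omega> ^^ n) x))) / N) ^ (2 ^ (d - 1)) \<le> U N * (m / N)"
    using exponential_sum_skew_product[OF \<gamma>, of d] by (elim exE conjE) simp
  note exp_sum = all[rule_format]
  \<comment> \<open>The summands belong to the smoothing error, the exponential sums and the
    replacement of the Haar integral by the grid average.\<close>
  define V where "V N = 2 * (1 + d * (3 + 2 * ln (1 + 2 * real N ^ 1))) + 2 ^ d * U N + 2" for N
  define s where "s = \<delta> / (\<delta> + d)"
  have \<delta>01: "0 < \<delta>" "\<delta> \<le> 1" using \<delta> by auto
  have s: "0 < s" "s \<le> 1" using \<delta>01 d by (auto simp: s_def)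
  have s\<delta>: "s * (\<delta> + d) = \<delta>" using \<delta>01 d by (simp add: s_def)
  have "subpolynomial V"
    unfolding V_def by (intro subpolynomial_add subpolynomial_mult subpolynomial_const subpolynomial_ln_power U) auto
  moreover have "\<bar>1 / N * birkhoff_sum d \<omega> \<phi> N x - (\<integral>y. \<phi> y \<partial>torus_haar d)\<bar>
      \<le> V N * holder_norm d \<alpha> \<phi> * real N powr (- (\<alpha> * \<delta> / (\<delta> + d)))"
    if \<alpha>: "0 < \<alpha>" "\<alpha> \<le> 1" and \<phi>: "\<phi> \<in> holder_functions d \<alpha>" and \<omega>: "diophantine \<gamma> \<omega>"
      and N: "N \<ge> 1" and x: "x \<in> torus d" for \<alpha> \<phi> \<omega> N x
  proof -
    have d0: "d > 0" using d by simp
    define H where "H = holder_seminorm d \<alpha> \<phi>"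
    define S where "S = sup_norm d \<phi>"
    have H0: "H \<ge> 0" unfolding H_def by (rule holder_seminorm_nonneg[OF d0 \<alpha>(1) \<phi>])
    have S0: "S \<ge> 0"
      unfolding S_def by (rule order_trans[OF abs_ge_zero abs_le_sup_norm[OF d0 \<alpha>(1) \<phi> x]])
    define M where "M = nat \<lfloor>real N powr s\<rfloor>"
    have N1: "1 \<le> real N powr s" using N s by (intro ge_one_powr_ge_zero) auto
    have M: "real M \<le> real N powr s" "real N powr s < real M + 1"
      unfolding M_def using N1 by linarith+
    have M1: "M \<ge> 1" using M N1 by linarith
    have "real N powr s \<le> real N powr 1" using N s by (intro powr_mono) auto
    then have MN: "M \<le> N" using M N by simp
    define z where "z n = (skew_product d \<omega> ^^ n) x" for n
    have z: "z n \<in> torus d" for n unfolding z_def by (rule orbit_in_torus[OF x])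
    define F where "F u = (\<Sum>y\<in>torus_grid d (2*M). \<phi> (torus_grid_point d (2*M) y) * torus_fejer d M (\<lambda>j. u j - grid_point (2*M) (y j))) / real (2*M) ^ d" for u
    define G where "G = (\<Sum>y\<in>torus_grid d (2*M). \<phi> (torus_grid_point d (2*M) y)) / real (2*M) ^ d"
    define R where "R = real N powr (- (s * \<alpha>))"
    define a where "a = (U N * (real M / N)) powr \<delta>"
    \<comment> \<open>Rounding down loses at most a factor 2 since M \<ge> 1, and 2^\<alpha> \<le> 2
      keeps the constant free of \<alpha>.\<close>
    have powM: "real M powr (-\<alpha>) \<le> 2 * R"
    proof -
      have "1 \<le> real M" using M1 by simp
      then have "real N powr s / 2 \<le> real M" using M by linarith
      moreover have "0 < real N powr s / 2" using N1 by linarith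
      ultimately have "real M powr (-\<alpha>) \<le> (real N powr s / 2) powr (-\<alpha>)"
        using \<alpha> by (intro powr_mono2') simp_all
      also have "\<dots> = 2 powr \<alpha> * R"
        unfolding powr_divide powr_minus[of 2 \<alpha>] powr_powr R_def by (simp add: field_simps)
      also have "\<dots> \<le> 2 powr 1 * R"
        using \<alpha> by (intro mult_right_mono powr_mono) (auto simp: R_def)
      finally show ?thesis by simp
    qed
    have hold: "\<And>u v. u \<in> torus d \<Longrightarrow> v \<in> torus d \<Longrightarrow> \<bar>\<phi> u - \<phi> v\<bar> \<le> H * torus_dist d u v powr \<alpha>"
      unfolding H_def by (rule abs_diff_le_holder_seminorm[OF d0 \<alpha>(1) \<phi>])
    have sup: "\<And>u. u \<in> torus d \<Longrightarrow> \<bar>\<phi> u\<bar> \<le> S"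
      unfolding S_def by (rule abs_le_sup_norm[OF d0 \<alpha>(1) \<phi>])
    define B where "B = 1 + d * (3 + 2 * ln (1 + 2 * real N))"
    have e1: "\<bar>(\<Sum>n<N. \<phi> (z n)) / N - (\<Sum>n<N. F (z n)) / N\<bar> \<le> H * (2 * R) * B"
    proof -
      have "\<bar>\<phi> (z n) - F (z n)\<bar> \<le> H * (2 * R) * B" for n
      proof -
        have "\<bar>\<phi> (z n) - F (z n)\<bar> \<le> H * real M powr (-\<alpha>) * (1 + d * (3 + 2 * ln (1 + 2 * real M)))"
          unfolding F_def using M1 by (intro fejer_approximation[OF _ d0 \<alpha> H0 hold z]) auto
        also have "\<dots> \<le> H * (2 * R) * B"
          unfolding B_def using powM H0 MN M1
          by (intro mult_mono add_mono mult_left_mono ln_mono) (auto intro!: mult_nonneg_nonneg add_nonneg_nonneg simp: R_def)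
        finally show ?thesis .
      qed
      then have "\<bar>\<Sum>n<N. \<phi> (z n) - F (z n)\<bar> \<le> (\<Sum>n<N. H * (2 * R) * B)"
        by (intro order_trans[OF sum_abs] sum_mono)
      then have "\<bar>\<Sum>n<N. \<phi> (z n) - F (z n)\<bar> / N \<le> H * (2 * R) * B"
        using N by (simp add: pos_divide_le_eq mult.commute)
      moreover have "(\<Sum>n<N. \<phi> (z n)) / N - (\<Sum>n<N. F (z n)) / N = (\<Sum>n<N. \<phi> (z n) - F (z n)) / N"
        by (simp add: sum_subtractf diff_divide_distrib)
      ultimately show ?thesis by simp
    qed
    have "\<bar>(\<Sum>n<N. F (z n)) / N - G\<bar> \<le> S * (a * sqrt (real (2*M) ^ d))"
      unfolding F_def G_def
    proof (rule fejer_mean_discrepancy[OF _ _ sup S0])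
      fix k assume k: "k \<in> freq_box d M" "\<exists>j<d. k j \<noteq> 0"
      let ?A = "norm (\<Sum>n<N. circle_char (torus_phase d k (z n))) / N"
      have "\<bar>k j\<bar> \<le> int M" if "j < d" for j
        using PiE_mem[OF k(1)[unfolded freq_box_def], of j] that by auto
      then have "?A ^ (2 ^ (d - 1)) \<le> U N * (M / N)"
        unfolding z_def using k(2) by (intro exp_sum[OF \<omega> M1 MN])
      then have "(?A ^ (2 ^ (d - 1))) powr \<delta> \<le> a"
        unfolding a_def using \<delta>01 by (intro powr_mono2) auto
      \<comment> \<open>As \<delta> is the reciprocal of 2^(d-1), this takes the root; a vanishing
        average is treated apart because the conversion to \<open>powr\<close> needs a positive
        base.\<close>
      moreover have "(?A ^ (2 ^ (d - 1))) powr \<delta> = ?A"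
      proof (cases "?A = 0")
        case False
        then have "?A > 0" by simp
        then have "(?A ^ (2 ^ (d - 1))) powr \<delta> = ?A powr (real (2 ^ (d - 1)) * \<delta>)"
          by (simp only: powr_realpow[symmetric] powr_powr)
        also have "real (2 ^ (d - 1)) * \<delta> = 1" by (simp add: \<delta>)
        finally show ?thesis using \<open>?A > 0\<close> by simp
      next
        case True
        show ?thesis unfolding True by simp
      qed
      ultimately show "?A \<le> a" by simp
    qed (use M1 N in \<open>auto simp: a_def\<close>)
    also have "\<dots> \<le> S * (2 ^ d * U N * R)"
    proof (intro mult_left_mono S0)
      have "a = U N powr \<delta> * (real M / N) powr \<delta>"
        unfolding a_def using U(2)[of N] by (intro powr_mult)
      also have "\<dots> \<le> U N powr 1 * (real N powr s / real N) powr \<delta>"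
        using U(2)[of N] \<delta>01 M by (intro mult_mono powr_mono powr_mono2 divide_right_mono) auto
      also have "U N powr 1 = U N" using U(2)[of N] by simp
      also have "(real N powr s / real N) powr \<delta> = real N powr (s * \<delta> - \<delta>)"
        using N by (simp add: powr_divide powr_powr powr_diff)
      finally have a: "a \<le> U N * real N powr (s * \<delta> - \<delta>)" .
      have "sqrt (real (2*M) ^ d) \<le> sqrt ((2 * real N powr s) ^ d)"
        using M by (intro real_sqrt_le_mono power_mono) auto
      also have "\<dots> = sqrt (2 ^ d) * sqrt ((real N powr s) ^ d)"
        by (simp add: power_mult_distrib real_sqrt_mult)
      also have "sqrt ((real N powr s) ^ d) = real N powr (s * d / 2)"
        using N by (simp add: powr_half_sqrt[symmetric] powr_powr flip: powr_realpow)
      also have "sqrt (2 ^ d) \<le> (2 :: real) ^ d"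
        by (intro real_le_lsqrt) (auto simp: power2_eq_square)
      finally have "sqrt (real (2*M) ^ d) \<le> 2 ^ d * real N powr (s * d / 2)"
        by (simp add: mult_right_mono)
      then have "a * sqrt (real (2*M) ^ d) \<le> (U N * real N powr (s * \<delta> - \<delta>)) * (2 ^ d * real N powr (s * d / 2))"
        using a U(2)[of N] by (intro mult_mono) auto
      also have "\<dots> = 2 ^ d * U N * real N powr (s * \<delta> - \<delta> + s * d / 2)"
        by (simp add: powr_add)
      \<comment> \<open>From s (\<delta> + d) = \<delta> one has s \<delta> - \<delta> = - s d, and
        half of it is spent on the square root of the number of frequencies.\<close>
      also have "s * \<delta> - \<delta> + s * d / 2 = - (s * (d / 2))"
        using s\<delta> by (simp add: algebra_simps)
      also have "real N powr (- (s * (d / 2))) \<le> R"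
      proof -
        have "\<alpha> \<le> d / 2" using \<alpha> d by linarith
        then have "s * \<alpha> \<le> s * (d / 2)" using s by (intro mult_left_mono) auto
        then show ?thesis unfolding R_def using N by (intro powr_mono) auto
      qed
      then have "2 ^ d * U N * real N powr (- (s * (d / 2))) \<le> 2 ^ d * U N * R"
        using U(2)[of N] by (intro mult_left_mono) auto
      finally show "a * sqrt (real (2*M) ^ d) \<le> 2 ^ d * U N * R" .
    qed
    finally have e2: "\<bar>(\<Sum>n<N. F (z n)) / N - G\<bar> \<le> S * (2 ^ d * U N * R)" .
    have "\<bar>G - (\<integral>y. \<phi> y \<partial>torus_haar d)\<bar> \<le> H * (1 / real (2*M)) powr \<alpha>"
      unfolding G_def using M1 by (intro integral_torus_haar_grid[OF _ d0 \<alpha>(1) H0 hold sup]) auto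
    also have "\<dots> \<le> H * (1 / real M) powr \<alpha>"
      using H0 M1 \<alpha> by (intro mult_left_mono powr_mono2) (auto simp: field_simps)
    also have "(1 / real M) powr \<alpha> = real M powr (-\<alpha>)"
      using M1 by (simp add: powr_divide powr_minus_divide)
    also have "H * real M powr (-\<alpha>) \<le> H * (2 * R)" using powM H0 by (intro mult_left_mono)
    finally have e3: "\<bar>G - (\<integral>y. \<phi> y \<partial>torus_haar d)\<bar> \<le> H * (2 * R)" .
    define T where "T = H + S"
    have R0: "R \<ge> 0" by (simp add: R_def)
    have B0: "B \<ge> 0" unfolding B_def by (intro add_nonneg_nonneg mult_nonneg_nonneg) auto
    have "\<bar>1 / N * birkhoff_sum d \<omega> \<phi> N x - (\<integral>y. \<phi> y \<partial>torus_haar d)\<bar>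
        \<le> H * (2 * R) * B + S * (2 ^ d * U N * R) + H * (2 * R)"
    proof -
      have "1 / N * birkhoff_sum d \<omega> \<phi> N x = (\<Sum>n<N. \<phi> (z n)) / N"
        by (simp add: birkhoff_sum_def z_def)
      then show ?thesis using e1 e2 e3 by linarith
    qed
    also have "\<dots> \<le> T * (2 * R) * B + T * (2 ^ d * U N * R) + T * (2 * R)"
    proof -
      have "H \<le> T" "S \<le> T" using H0 S0 by (simp_all add: T_def)
      moreover have "0 \<le> 2 ^ d * U N * R" using U(2)[of N] R0 by simp
      ultimately show ?thesis using R0 B0 by (intro add_mono mult_right_mono) simp_all
    qed
    also have "\<dots> = V N * T * R" by (simp add: V_def B_def algebra_simps)
    also have "T = holder_norm d \<alpha> \<phi>" by (simp add: T_def H_def S_def holder_norm_def)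
    also have "R = real N powr (- (\<alpha> * \<delta> / (\<delta> + d)))" by (simp add: R_def s_def mult.commute)
    finally show ?thesis .
  qed
  ultimately show ?thesis by blast
qed

text \<open>With W = 1 + |V| the exponent \<eta> = ln W / ln N makes N^\<eta> equal to W for N \<ge>
  2, and W \<ge> 1 makes it nonnegative there. At N = 1 every power is 1, so the constant W 1 takes
  over the bound.\<close>

lemma subpolynomial_exponent:
  assumes V: "subpolynomial V"
  obtains C \<eta> where "\<eta> \<longlonglongrightarrow> 0" "C \<ge> 0" "\<And>N. N \<ge> 1 \<Longrightarrow> V N \<le> C * real N powr \<eta> N"
proof -
  define W where "W N = 1 + \<bar>V N\<bar>" for N
  have W1: "W N \<ge> 1" for N by (simp add: W_def)
  have "subpolynomial (\<lambda>N. \<bar>V N\<bar>)" by (rule subpolynomial_mono[OF V]) simp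
  then have W: "subpolynomial W" unfolding W_def by (intro subpolynomial_add subpolynomial_const)
  define \<eta> where "\<eta> N = ln (W N) / ln (real N)" for N
  have "\<eta> \<longlonglongrightarrow> 0"
  proof (rule LIMSEQ_I)
    fix e :: real assume e: "e > 0"
    then obtain C where C: "C > 0" "\<And>N. N \<ge> 1 \<Longrightarrow> \<bar>W N\<bar> \<le> C * real N powr (e / 2)"
      using subpolynomialD[OF W, of "e / 2"] by (metis half_gt_zero)
    have "filterlim (\<lambda>N. ln (real N)) at_top sequentially"
      by (rule filterlim_compose[OF ln_at_top filterlim_real_sequentially])
    then have "\<forall>\<^sub>F N in sequentially. ln (real N) > max 0 (2 / e * ln C)"
      unfolding filterlim_at_top_dense by blast
    \<comment> \<open>Beyond \<open>N0\<close> the constant \<open>C\<close> is worth less than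
      another factor N^(e/2), so the two halves add up to less than e.\<close>
    then obtain N0 where N0: "\<And>N. N \<ge> N0 \<Longrightarrow> ln (real N) > max 0 (2 / e * ln C)"
      unfolding eventually_sequentially by blast
    have "norm (\<eta> N - 0) < e" if N: "N \<ge> max 1 N0" for N
    proof -
      have lnN: "ln (real N) > 0" "ln C < e / 2 * ln (real N)"
        using N0[of N] N e by (auto simp: field_simps)
      have "ln (W N) \<le> ln (C * real N powr (e / 2))"
        using C(2)[of N] W1[of N] N by (intro ln_mono) auto
      also have "\<dots> = ln C + e / 2 * ln (real N)"
        using C N by (simp add: ln_mult ln_powr)
      also have "\<dots> < e * ln (real N)" using lnN by simp
      finally have "\<eta> N < e" using lnN by (simp add: \<eta>_def pos_divide_less_eq)
      moreover have "\<eta> N \<ge> 0" using lnN W1[of N] by (simp add: \<eta>_def)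
      ultimately show ?thesis by simp
    qed
    then show "\<exists>no. \<forall>n\<ge>no. norm (\<eta> n - 0) < e" by blast
  qed
  moreover have "V N \<le> W 1 * real N powr \<eta> N" if N: "N \<ge> 1" for N
  proof (cases "N = 1")
    case False
    then have "ln (real N) > 0" using N by simp
    then have "real N powr \<eta> N = W N" using N W1[of N] by (simp add: powr_def \<eta>_def)
    moreover have "W N \<le> W 1 * W N" using mult_right_mono[OF W1[of 1], of "W N"] W1[of N] by simp
    ultimately show ?thesis by (simp add: W_def)
  qed (simp add: W_def)
  moreover have "W 1 \<ge> 0" using W1[of 1] by simp
  ultimately show ?thesis using that by blast
qed

theorem theorem4:
  fixes d :: nat and \<gamma> \<delta> :: real
  assumes "d \<ge> 2" and "\<gamma> > 0" and "\<delta> = 1 / 2 ^ (d - 1)"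
  shows "\<exists>(C :: real) (\<eta> :: nat \<Rightarrow> real). \<eta> \<longlonglongrightarrow> 0 \<and>
    (\<forall>(\<alpha> :: real) (\<phi> :: (nat \<Rightarrow> circle) \<Rightarrow> real) (\<omega> :: circle).
       0 < \<alpha> \<longrightarrow> \<alpha> \<le> 1 \<longrightarrow> \<phi> \<in> holder_functions d \<alpha> \<longrightarrow>
       (\<forall>k :: int. k \<noteq> 0 \<longrightarrow>
          circle_norm (circle_int_mult k \<omega>) \<ge> \<gamma> / (\<bar>k\<bar> * (ln (\<bar>k\<bar> + 1))\<^sup>2)) \<longrightarrow>
       (\<forall>N \<ge> 1.
          sup_norm d (\<lambda>x. 1 / N * birkhoff_sum d \<omega> \<phi> N x - (\<integral>y. \<phi> y \<partial>torus_haar d))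
            \<le> C * holder_norm d \<alpha> \<phi> * (1 / N powr (\<alpha> * \<delta> / (\<delta> + d) - \<eta> N))))"
proof -
  obtain V where V: "subpolynomial V"
    and "\<forall>\<alpha> \<phi> \<omega> N x. 0 < \<alpha> \<longrightarrow> \<alpha> \<le> 1 \<longrightarrow> \<phi> \<in> holder_functions d \<alpha> \<longrightarrow>
       diophantine \<gamma> \<omega> \<longrightarrow> N \<ge> 1 \<longrightarrow> x \<in> torus d \<longrightarrow>
       \<bar>1 / N * birkhoff_sum d \<omega> \<phi> N x - (\<integral>y. \<phi> y \<partial>torus_haar d)\<bar>
         \<le> V N * holder_norm d \<alpha> \<phi> * real N powr (- (\<alpha> * \<delta> / (\<delta> + d)))"
    using birkhoff_average_rate[OF assms] by (elim exE conjE) (rule that)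
  note rate = this(2)[rule_format]
  obtain C \<eta> where \<eta>: "\<eta> \<longlonglongrightarrow> 0" and C: "C \<ge> 0" "\<And>N. N \<ge> 1 \<Longrightarrow> V N \<le> C * real N powr \<eta> N"
    by (rule subpolynomial_exponent[OF V]) (rule that)
  show ?thesis
  proof (intro exI[of _ C] exI[of _ \<eta>] conjI \<eta> allI impI)
    fix \<alpha> :: real and \<phi> :: "(nat \<Rightarrow> circle) \<Rightarrow> real" and \<omega> :: circle and N :: nat
    assume \<alpha>: "0 < \<alpha>" "\<alpha> \<le> 1" and \<phi>: "\<phi> \<in> holder_functions d \<alpha>" and N: "N \<ge> 1"
      and "\<forall>k :: int. k \<noteq> 0 \<longrightarrow> circle_norm (circle_int_mult k \<omega>) \<ge> \<gamma> / (\<bar>k\<bar> * (ln (\<bar>k\<bar> + 1))\<^sup>2)"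
    then have \<omega>: "diophantine \<gamma> \<omega>" unfolding diophantine_def by blast
    have d0: "d > 0" using assms(1) by simp
    \<comment> \<open>A point of the torus is needed twice: for the sign of the sup norm of \<phi>,
      and for the nonemptiness that bounding a real supremum from above requires.\<close>
    have zero: "(\<lambda>_\<in>{..<d}. 0 :: circle) \<in> torus d" by (simp add: torus_def)
    have norm0: "holder_norm d \<alpha> \<phi> \<ge> 0"
      unfolding holder_norm_def
      using holder_seminorm_nonneg[OF d0 \<alpha>(1) \<phi>] order_trans[OF abs_ge_zero abs_le_sup_norm[OF d0 \<alpha>(1) \<phi> zero]]
      by simp
    have "\<bar>1 / N * birkhoff_sum d \<omega> \<phi> N x - (\<integral>y. \<phi> y \<partial>torus_haar d)\<bar>
        \<le> C * holder_norm d \<alpha> \<phi> * (1 / N powr (\<alpha> * \<delta> / (\<delta> + d) - \<eta> N))" if x: "x \<in> torus d" for x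
    proof -
      have "\<bar>1 / N * birkhoff_sum d \<omega> \<phi> N x - (\<integral>y. \<phi> y \<partial>torus_haar d)\<bar>
          \<le> V N * holder_norm d \<alpha> \<phi> * real N powr (- (\<alpha> * \<delta> / (\<delta> + d)))"
        by (rule rate[OF \<alpha> \<phi> \<omega> N x])
      also have "\<dots> \<le> (C * real N powr \<eta> N) * holder_norm d \<alpha> \<phi> * real N powr (- (\<alpha> * \<delta> / (\<delta> + d)))"
        using C(2)[OF N] norm0 by (intro mult_right_mono) auto
      also have "\<dots> = C * holder_norm d \<alpha> \<phi> * (1 / N powr (\<alpha> * \<delta> / (\<delta> + d) - \<eta> N))"
        by (simp add: powr_diff powr_minus_divide)
      finally show ?thesis .
    qed
    then show "sup_norm d (\<lambda>x. 1 / N * birkhoff_sum d \<omega> \<phi> N x - (\<integral>y. \<phi> y \<partial>torus_haar d))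
        \<le> C * holder_norm d \<alpha> \<phi> * (1 / N powr (\<alpha> * \<delta> / (\<delta> + d) - \<eta> N))"
      unfolding sup_norm_def using zero by (intro cSUP_least) auto
  qed
qed

end
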